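(* Let $\Bbbk$ be a commutative ring, $(\mathbb{X},\Gamma/{\sim})$ a triple with $\Bbbk$-linear path category $\mathcal{C}$, $\mathcal{I}$ a path based ideal in $\mathcal{C}$, and $\mathfrak{P}$ a screen of $(\mathbb{X},\Gamma/{\sim})$. Then the class $\Sigma_{\mathfrak{P}}$ of morphisms in $\overline{\mathcal{A}}^{\mathfrak{P}}=\mathcal{C}/\overline{\mathcal{I}}^{\mathfrak{P}}$ admits a calculus of fractions.
   Context: TRIPLES. A path in a nonempty set $\mathbb{X}$ is any function $\gamma:[0,1]\to\mathbb{X}$; $\mathrm{im}(\gamma)$ is its image. If $\gamma(1)=\gamma'(0)$, then $\gamma\cdot\gamma'$ is the path equal to $\gamma(2t)$ for $0\le t\le\frac12$ and to $\gamma'(2t-1)$ for $\frac12\le t\le1$. A triple $(\mathbb{X},\Gamma/{\sim})$ consists of a nonempty set $\mathbb{X}$, a set $\Gamma$ of paths in $\mathbb{X}$, and an equivalence relation $\sim$ on $\Gamma$ (equivalent paths have the same endpoints) such that: (a) $\gamma,\gamma'\in\Gamma$ with $\gamma(1)=\gamma'(0)$ implies $\gamma\cdot\gamma'\in\Gamma$; (b) if $\gamma\in\Gamma$ and $\phi:[0,1]\to[0,1]$ is weakly order preserving and sends intervals to intervals, then $\gamma\circ\phi\in\Gamma$; (c) all constant paths are in $\Gamma$; (d) a path equivalent to a constant path is constant; (e) if in (b) also $\phi(0)=0$, $\phi(1)=1$, then $\gamma\sim\gamma\circ\phi$; (f) if $\gamma,\gamma',\rho,\rho'\in\Gamma$ and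 $\rho\cdot\gamma\cdot\rho'$, $\rho\cdot\gamma'\cdot\rho'$ are defined and in $\Gamma$, then $\gamma\sim\gamma'$ if and only if $\rho\cdot\gamma\cdot\rho'\sim\rho\cdot\gamma'\cdot\rho'$. The class of $\gamma$ is $[\gamma]$. SCREENS. A screen of $(\mathbb{X},\Gamma/{\sim})$ is a partition $\mathfrak{P}$ of $\mathbb{X}$, whose elements are called pixels, such that: (S1) if $\gamma,\gamma'\in\Gamma$ have the same start and the same end and $\mathrm{im}(\gamma)\subset\mathsf{X}\in\mathfrak{P}$, then $\gamma\sim\gamma'$ if and only if $\mathrm{im}(\gamma')\subset\mathsf{X}$; (S2) any two points $x,y$ of a pixel $\mathsf{X}$ are joined by a finite walk $\gamma_0\cdot\gamma_1^{-1}\cdot\gamma_2\cdots\gamma_{2n-1}^{-1}\cdot\gamma_{2n}$ from $x$ to $y$ (where $\gamma^{-1}$ is $\gamma$ run backwards) with all $\gamma_i\in\Gamma$ and $\mathrm{im}(\gamma_i)\subset\mathsf{X}$; (S3) if $\rho,\gamma\in\Gamma$, $\rho(0)=\gamma(0)$ and $\mathrm{im}(\rho)$ lies in a pixel, then there are $\rho',\gamma'\in\Gamma$ with $\mathrm{im}(\rho')$ in a pixel and $\gamma\cdot\rho'\sim\rho\cdot\gamma'$; dually, if $\rho',\gamma'\in\Gamma$, $\rho'(1)=\gamma'(1)$ and $\mathrm{im}(\rho')$ lies in a pixel, then there are $\rho,\gamma\in\Gamma$ with $\mathrm{im}(\rho)$ in a pixel and $\gamma\cdot\rho'\sim\rho\cdot\gamma'$;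 (S4) for every $\gamma\in\Gamma$ there are a finite partition $\{I_i\}_{i=1}^n$ of $[0,1]$ into subintervals (listed in increasing order) and pixels $(\mathsf{X}_1,\dots,\mathsf{X}_n)$ with $\gamma(I_i)\subset\mathsf{X}_i$, where for $i\ne j$ the equality $\mathsf{X}_i=\mathsf{X}_j$ is allowed only if $|i-j|>1$; (S5) if $\gamma,\gamma'\in\Gamma$ have the same start and the same end and admit the same partition $\{I_i\}$ and the same list of pixels as in (S4), then $\gamma\sim\gamma'$. LINEAR PATH CATEGORY. $\mathcal{C}$ has objects $\mathbb{X}\sqcup\{0\}$ with $0$ a zero object; for $x,y\in\mathbb{X}$, $\mathrm{Hom}_{\mathcal{C}}(x,y)$ is the free $\Bbbk$-module on $\{[\gamma]\mid\gamma\in\Gamma,\gamma(0)=x,\gamma(1)=y\}$, with composition extending $[\gamma']\circ[\gamma]=[\gamma\cdot\gamma']$ bilinearly. An ideal $\mathcal{I}$ of $\mathcal{C}$ is path based if it is generated by finite sums $\sum_i\lambda_i[\gamma_i]$ with $\gamma_i\in\Gamma$ and each $\lambda_i\in\Bbbk$ not a zero divisor ($\mathcal{I}=0$ is allowed). Put $\mathcal{A}=\mathcal{C}/\mathcal{I}$. COMPLETION AND $\Sigma_{\mathfrak{P}}$. Paths $\gamma,\gamma'\in\Gamma$ are $\mathfrak{P}$-equivalent if there are $\rho_1,\rho_2,\rho_3,\rho_4\in\Gamma$ with $\mathrm{im}(\rho_1)\cup\mathrm{im}(\rho_2)$ in one pixel, $\mathrm{im}(\rho_3)\cup\mathrm{im}(\rho_4)$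 in one pixel, and $\rho_1\cdot\gamma\cdot\rho_3\sim\rho_2\cdot\gamma'\cdot\rho_4$. Morphisms $\sum_{i=1}^m\lambda_i[\gamma_i]$ and $\sum_{i=1}^m\lambda'_i[\gamma'_i]$ are $\mathfrak{P}$-equivalent if, up to permutation, $\lambda_i=\lambda_i'$ and $\gamma_i,\gamma'_i$ are $\mathfrak{P}$-equivalent for all $i$. $\overline{\mathcal{I}}^{\mathfrak{P}}$ is the ideal generated by all $f$ that are $\mathfrak{P}$-equivalent to some $g\in\mathcal{I}$. A pixel $\mathsf{X}$ is pre-dead if there is $\rho\in\Gamma$ with $\mathrm{im}(\rho)\subset\mathsf{X}$ and $[\rho]=0$ in $\mathcal{A}$. $\Sigma_{\mathfrak{P}}$ consists of the morphisms $[\rho]\neq0$ of $\overline{\mathcal{A}}^{\mathfrak{P}}$ with $\mathrm{im}(\rho)$ in a pixel, and of the zero morphisms $x\to y$ with $x,y$ in a common pre-dead pixel. CALCULUS OF FRACTIONS. A class $\Sigma$ of morphisms of a category $\mathcal{D}$ admits a calculus of fractions if: (1) $\Sigma$ contains all identities and is closed under composition; (2) for $\sigma:x\to x'$ in $\Sigma$ and $f:x\to y$ there are $\sigma':y\to y'$ in $\Sigma$ and $f':x'\to y'$ with $f'\sigma=\sigma'f$; (3) if $\sigma:w\to x$ is in $\Sigma$ and $f,g:x\rightrightarrows y$ satisfy $f\sigma=g\sigma$, there is $\sigma':y\to z$ in $\Sigma$ with $\sigma'f=\sigma'g$; (4) and (5) the duals of (2) and (3). (Here the identity of the zero object is understood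 to be included in $\Sigma_{\mathfrak{P}}$.) *)

theory Defs
  imports "HOL-Analysis.Analysis" "HOL-Library.Disjoint_Sets" "HOL-Library.Poly_Mapping"
begin

section \<open>Categories, ideals, quotients, calculus of fractions\<close>

text \<open>Hom-sets need not be disjoint, so morphisms are always considered together with their source
  and target; \<open>Comp D x y z g f\<close> is the composite \<open>g \<circ> f\<close> of \<open>f : x \<rightarrow> y\<close> and \<open>g : y \<rightarrow> z\<close>.\<close>

record ('o, 'm) category =
  Obj :: "'o set"
  Hom :: "'o \<Rightarrow> 'o \<Rightarrow> 'm set"
  Comp :: "'o \<Rightarrow> 'o \<Rightarrow> 'o \<Rightarrow> 'm \<Rightarrow> 'm \<Rightarrow> 'm"
  Ident :: "'o \<Rightarrow> 'm"

definition is_category :: "('o, 'm) category \<Rightarrow> bool" where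
  "is_category D \<longleftrightarrow>
     (\<forall>x\<in>Obj D. Ident D x \<in> Hom D x x) \<and>
     (\<forall>x\<in>Obj D. \<forall>y\<in>Obj D. \<forall>z\<in>Obj D. \<forall>f\<in>Hom D x y. \<forall>g\<in>Hom D y z. Comp D x y z g f \<in> Hom D x z) \<and>
     (\<forall>x\<in>Obj D. \<forall>y\<in>Obj D. \<forall>f\<in>Hom D x y.
        Comp D x x y f (Ident D x) = f \<and> Comp D x y y (Ident D y) f = f) \<and>
     (\<forall>w\<in>Obj D. \<forall>x\<in>Obj D. \<forall>y\<in>Obj D. \<forall>z\<in>Obj D. \<forall>f\<in>Hom D w x. \<forall>g\<in>Hom D x y. \<forall>h\<in>Hom D y z.
        Comp D w x z (Comp D x y z h g) f = Comp D w y z h (Comp D w x y g f))"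

text \<open>A class of morphisms is a family \<open>S x y \<subseteq> Hom D x y\<close>.\<close>

definition admits_calculus_of_fractions ::
  "('o, 'm) category \<Rightarrow> ('o \<Rightarrow> 'o \<Rightarrow> 'm set) \<Rightarrow> bool" where
  "admits_calculus_of_fractions D S \<longleftrightarrow>
     is_category D \<and>
     (\<forall>x\<in>Obj D. \<forall>y\<in>Obj D. S x y \<subseteq> Hom D x y) \<and>
     \<comment> \<open>(1)\<close>
     (\<forall>x\<in>Obj D. Ident D x \<in> S x x) \<and>
     (\<forall>x\<in>Obj D. \<forall>y\<in>Obj D. \<forall>z\<in>Obj D. \<forall>\<sigma>\<in>S x y. \<forall>\<tau>\<in>S y z. Comp D x y z \<tau> \<sigma> \<in> S x z) \<and>
     \<comment> \<open>(2)\<close>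
     (\<forall>x\<in>Obj D. \<forall>x'\<in>Obj D. \<forall>y\<in>Obj D. \<forall>\<sigma>\<in>S x x'. \<forall>f\<in>Hom D x y.
        \<exists>y'\<in>Obj D. \<exists>\<sigma>'\<in>S y y'. \<exists>f'\<in>Hom D x' y'. Comp D x x' y' f' \<sigma> = Comp D x y y' \<sigma>' f) \<and>
     \<comment> \<open>(3)\<close>
     (\<forall>w\<in>Obj D. \<forall>x\<in>Obj D. \<forall>y\<in>Obj D. \<forall>\<sigma>\<in>S w x. \<forall>f\<in>Hom D x y. \<forall>g\<in>Hom D x y.
        Comp D w x y f \<sigma> = Comp D w x y g \<sigma> \<longrightarrow>
        (\<exists>z\<in>Obj D. \<exists>\<sigma>'\<in>S y z. Comp D x y z \<sigma>' f = Comp D x y z \<sigma>' g)) \<and>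
     \<comment> \<open>(4)\<close>
     (\<forall>x\<in>Obj D. \<forall>x'\<in>Obj D. \<forall>y\<in>Obj D. \<forall>\<sigma>\<in>S x' x. \<forall>f\<in>Hom D y x.
        \<exists>y'\<in>Obj D. \<exists>\<sigma>'\<in>S y' y. \<exists>f'\<in>Hom D y' x'. Comp D y' x' x \<sigma> f' = Comp D y' y x f \<sigma>') \<and>
     \<comment> \<open>(5)\<close>
     (\<forall>w\<in>Obj D. \<forall>x\<in>Obj D. \<forall>y\<in>Obj D. \<forall>\<sigma>\<in>S x w. \<forall>f\<in>Hom D y x. \<forall>g\<in>Hom D y x.
        Comp D y x w \<sigma> f = Comp D y x w \<sigma> g \<longrightarrow>
        (\<exists>z\<in>Obj D. \<exists>\<sigma>'\<in>S z y. Comp D z y x f \<sigma>' = Comp D z y x g \<sigma>'))"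

text \<open>Two-sided ideals of a category whose Hom-sets are subgroups of the group \<open>'m\<close>. In a
  \<open>k\<close>-linear category, closure under scalars follows from closure under composition with
  multiples of identities.\<close>

definition is_ideal :: "('o, 'm::ab_group_add) category \<Rightarrow> ('o \<Rightarrow> 'o \<Rightarrow> 'm set) \<Rightarrow> bool" where
  "is_ideal C I \<longleftrightarrow>
     (\<forall>x\<in>Obj C. \<forall>y\<in>Obj C. I x y \<subseteq> Hom C x y \<and> 0 \<in> I x y \<and>
        (\<forall>f\<in>I x y. \<forall>g\<in>I x y. f + g \<in> I x y) \<and> (\<forall>f\<in>I x y. - f \<in> I x y)) \<and>
     (\<forall>x\<in>Obj C. \<forall>y\<in>Obj C. \<forall>z\<in>Obj C. \<forall>f\<in>I x y. \<forall>g\<in>Hom C y z. Comp C x y z g f \<in> I x z) \<and>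
     (\<forall>x\<in>Obj C. \<forall>y\<in>Obj C. \<forall>z\<in>Obj C. \<forall>f\<in>Hom C x y. \<forall>g\<in>I y z. Comp C x y z g f \<in> I x z)"

definition ideal_generated ::
  "('o, 'm::ab_group_add) category \<Rightarrow> ('o \<Rightarrow> 'o \<Rightarrow> 'm set) \<Rightarrow> 'o \<Rightarrow> 'o \<Rightarrow> 'm set" where
  "ideal_generated C S x y =
     {f \<in> Hom C x y. \<forall>I. is_ideal C I \<and> (\<forall>u\<in>Obj C. \<forall>v\<in>Obj C. S u v \<subseteq> I u v) \<longrightarrow> f \<in> I x y}"

definition residue_class ::
  "('o \<Rightarrow> 'o \<Rightarrow> 'm::ab_group_add set) \<Rightarrow> 'o \<Rightarrow> 'o \<Rightarrow> 'm \<Rightarrow> 'm set" where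
  "residue_class I x y f = (\<lambda>h. f + h) ` I x y"

text \<open>In \<open>Comp\<close>, all the sets in the union coincide when \<open>I\<close> is an ideal.\<close>

definition quotient_category ::
  "('o, 'm::ab_group_add) category \<Rightarrow> ('o \<Rightarrow> 'o \<Rightarrow> 'm set) \<Rightarrow> ('o, 'm set) category" where
  "quotient_category C I =
     \<lparr>Obj = Obj C,
      Hom = (\<lambda>x y. residue_class I x y ` Hom C x y),
      Comp = (\<lambda>x y z G F. \<Union>g\<in>G. \<Union>f\<in>F. residue_class I x z (Comp C x y z g f)),
      Ident = (\<lambda>x. residue_class I x x (Ident C x))\<rparr>"


section \<open>Triples\<close>

text \<open>A path in \<open>X\<close> is an element of \<open>{0..1} \<rightarrow>\<^sub>E X\<close>; the extensional function space makes
  equality of Isabelle functions agree with equality of functions on the unit interval.\<close>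

definition path_concat :: "(real \<Rightarrow> 'a) \<Rightarrow> (real \<Rightarrow> 'a) \<Rightarrow> real \<Rightarrow> 'a" (infixr \<open>\<bullet>\<^sub>p\<close> 75) where
  "\<gamma> \<bullet>\<^sub>p \<gamma>' = (\<lambda>t\<in>{0..1}. if t \<le> 1/2 then \<gamma> (2 * t) else \<gamma>' (2 * t - 1))"

definition composable :: "(real \<Rightarrow> 'a) \<Rightarrow> (real \<Rightarrow> 'a) \<Rightarrow> bool" where
  "composable \<gamma> \<gamma>' \<longleftrightarrow> \<gamma> 1 = \<gamma>' 0"

definition path_reverse :: "(real \<Rightarrow> 'a) \<Rightarrow> real \<Rightarrow> 'a" where
  "path_reverse \<gamma> = (\<lambda>t\<in>{0..1}. \<gamma> (1 - t))"

definition const_path :: "'a \<Rightarrow> real \<Rightarrow> 'a" where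
  "const_path x = (\<lambda>t\<in>{0..1}. x)"

abbreviation im :: "(real \<Rightarrow> 'a) \<Rightarrow> 'a set" where
  "im \<gamma> \<equiv> \<gamma> ` {0..1}"

definition reparametrization :: "(real \<Rightarrow> real) \<Rightarrow> bool" where
  "reparametrization \<phi> \<longleftrightarrow> \<phi> \<in> {0..1} \<rightarrow> {0..1} \<and> mono_on {0..1} \<phi> \<and>
     (\<forall>J\<subseteq>{0..1}. is_interval J \<longrightarrow> is_interval (\<phi> ` J))"

record 'a triple =
  points :: "'a set"
  paths :: "(real \<Rightarrow> 'a) set"
  path_rel :: "((real \<Rightarrow> 'a) \<times> (real \<Rightarrow> 'a)) set"

definition path_equiv :: "'a triple \<Rightarrow> (real \<Rightarrow> 'a) \<Rightarrow> (real \<Rightarrow> 'a) \<Rightarrow> bool" where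
  "path_equiv T \<gamma> \<gamma>' \<longleftrightarrow> (\<gamma>, \<gamma>') \<in> path_rel T"

definition is_triple :: "'a triple \<Rightarrow> bool" where
  "is_triple T \<longleftrightarrow>
     points T \<noteq> {} \<and>
     paths T \<subseteq> {0..1} \<rightarrow>\<^sub>E points T \<and>
     equiv (paths T) (path_rel T) \<and>
     (\<forall>\<gamma> \<gamma>'. path_equiv T \<gamma> \<gamma>' \<longrightarrow> \<gamma> 0 = \<gamma>' 0 \<and> \<gamma> 1 = \<gamma>' 1) \<and>
     \<comment> \<open>(a)\<close>
     (\<forall>\<gamma>\<in>paths T. \<forall>\<gamma>'\<in>paths T. composable \<gamma> \<gamma>' \<longrightarrow> \<gamma> \<bullet>\<^sub>p \<gamma>' \<in> paths T) \<and>
     \<comment> \<open>(b)\<close>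
     (\<forall>\<gamma>\<in>paths T. \<forall>\<phi>. reparametrization \<phi> \<longrightarrow> compose {0..1} \<gamma> \<phi> \<in> paths T) \<and>
     \<comment> \<open>(c)\<close>
     (\<forall>x\<in>points T. const_path x \<in> paths T) \<and>
     \<comment> \<open>(d)\<close>
     (\<forall>\<gamma>\<in>paths T. \<forall>x\<in>points T. path_equiv T \<gamma> (const_path x) \<longrightarrow> (\<exists>y\<in>points T. \<gamma> = const_path y)) \<and>
     \<comment> \<open>(e)\<close>
     (\<forall>\<gamma>\<in>paths T. \<forall>\<phi>. reparametrization \<phi> \<and> \<phi> 0 = 0 \<and> \<phi> 1 = 1 \<longrightarrow>
        path_equiv T \<gamma> (compose {0..1} \<gamma> \<phi>)) \<and>
     \<comment> \<open>(f)\<close>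
     (\<forall>\<gamma>\<in>paths T. \<forall>\<gamma>'\<in>paths T. \<forall>\<rho>\<in>paths T. \<forall>\<rho>'\<in>paths T.
        composable \<rho> \<gamma> \<and> composable \<gamma> \<rho>' \<and> composable \<rho> \<gamma>' \<and> composable \<gamma>' \<rho>' \<and>
        \<rho> \<bullet>\<^sub>p \<gamma> \<bullet>\<^sub>p \<rho>' \<in> paths T \<and> \<rho> \<bullet>\<^sub>p \<gamma>' \<bullet>\<^sub>p \<rho>' \<in> paths T \<longrightarrow>
        (path_equiv T \<gamma> \<gamma>' \<longleftrightarrow> path_equiv T (\<rho> \<bullet>\<^sub>p \<gamma> \<bullet>\<^sub>p \<rho>') (\<rho> \<bullet>\<^sub>p \<gamma>' \<bullet>\<^sub>p \<rho>')))"


section \<open>Screens\<close>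

definition in_pixel :: "'a set set \<Rightarrow> 'a set \<Rightarrow> bool" where
  "in_pixel P A \<longleftrightarrow> (\<exists>X\<in>P. A \<subseteq> X)"

text \<open>The points \<open>x\<close> and \<open>y\<close> are joined, inside the set \<open>X\<close>, by a walk whose odd-numbered
  pieces are traversed backwards.\<close>

definition walk_connected :: "'a triple \<Rightarrow> 'a set \<Rightarrow> 'a \<Rightarrow> 'a \<Rightarrow> bool" where
  "walk_connected T X x y \<longleftrightarrow>
     (\<exists>n \<gamma>. (\<forall>i\<le>2 * n. \<gamma> i \<in> paths T \<and> im (\<gamma> i) \<subseteq> X) \<and>
        (let w = (\<lambda>i::nat. if even i then \<gamma> i else path_reverse (\<gamma> i)) in
           w 0 0 = x \<and> w (2 * n) 1 = y \<and> (\<forall>i<2 * n. composable (w i) (w (Suc i)))))"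

definition interval_partition :: "nat \<Rightarrow> (nat \<Rightarrow> real set) \<Rightarrow> bool" where
  "interval_partition n J \<longleftrightarrow>
     (\<forall>i<n. J i \<noteq> {} \<and> is_interval (J i)) \<and> (\<Union>i<n. J i) = {0..1} \<and>
     (\<forall>i<n. \<forall>j<n. i < j \<longrightarrow> (\<forall>s\<in>J i. \<forall>t\<in>J j. s < t))"

definition pixel_subdivision ::
  "'a set set \<Rightarrow> (real \<Rightarrow> 'a) \<Rightarrow> nat \<Rightarrow> (nat \<Rightarrow> real set) \<Rightarrow> (nat \<Rightarrow> 'a set) \<Rightarrow> bool" where
  "pixel_subdivision P \<gamma> n J X \<longleftrightarrow>
     interval_partition n J \<and>
     (\<forall>i<n. X i \<in> P \<and> \<gamma> ` J i \<subseteq> X i) \<and>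
     (\<forall>i<n. \<forall>j<n. i \<noteq> j \<and> X i = X j \<longrightarrow> \<bar>int i - int j\<bar> > 1)"

definition is_screen :: "'a triple \<Rightarrow> 'a set set \<Rightarrow> bool" where
  "is_screen T P \<longleftrightarrow>
     partition_on (points T) P \<and>
     \<comment> \<open>(S1)\<close>
     (\<forall>\<gamma>\<in>paths T. \<forall>\<gamma>'\<in>paths T. \<forall>X\<in>P. \<gamma> 0 = \<gamma>' 0 \<and> \<gamma> 1 = \<gamma>' 1 \<and> im \<gamma> \<subseteq> X \<longrightarrow>
        (path_equiv T \<gamma> \<gamma>' \<longleftrightarrow> im \<gamma>' \<subseteq> X)) \<and>
     \<comment> \<open>(S2)\<close>
     (\<forall>X\<in>P. \<forall>x\<in>X. \<forall>y\<in>X. walk_connected T X x y) \<and>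
     \<comment> \<open>(S3)\<close>
     (\<forall>\<rho>\<in>paths T. \<forall>\<gamma>\<in>paths T. \<rho> 0 = \<gamma> 0 \<and> in_pixel P (im \<rho>) \<longrightarrow>
        (\<exists>\<rho>'\<in>paths T. \<exists>\<gamma>'\<in>paths T. in_pixel P (im \<rho>') \<and> composable \<gamma> \<rho>' \<and> composable \<rho> \<gamma>' \<and>
           path_equiv T (\<gamma> \<bullet>\<^sub>p \<rho>') (\<rho> \<bullet>\<^sub>p \<gamma>'))) \<and>
     (\<forall>\<rho>'\<in>paths T. \<forall>\<gamma>'\<in>paths T. \<rho>' 1 = \<gamma>' 1 \<and> in_pixel P (im \<rho>') \<longrightarrow>
        (\<exists>\<rho>\<in>paths T. \<exists>\<gamma>\<in>paths T. in_pixel P (im \<rho>) \<and> composable \<gamma> \<rho>' \<and> composable \<rho> \<gamma>' \<and>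
           path_equiv T (\<gamma> \<bullet>\<^sub>p \<rho>') (\<rho> \<bullet>\<^sub>p \<gamma>'))) \<and>
     \<comment> \<open>(S4)\<close>
     (\<forall>\<gamma>\<in>paths T. \<exists>n J X. pixel_subdivision P \<gamma> n J X) \<and>
     \<comment> \<open>(S5)\<close>
     (\<forall>\<gamma>\<in>paths T. \<forall>\<gamma>'\<in>paths T. \<gamma> 0 = \<gamma>' 0 \<and> \<gamma> 1 = \<gamma>' 1 \<and>
        (\<exists>n J X. pixel_subdivision P \<gamma> n J X \<and> pixel_subdivision P \<gamma>' n J X) \<longrightarrow> path_equiv T \<gamma> \<gamma>')"


section \<open>The linear path category\<close>

text \<open>The sort \<open>{comm_ring, comm_monoid_mult}\<close> describes commutative rings with 1; unlike
  \<open>comm_ring_1\<close> it does not exclude the zero ring. The object \<open>None\<close> is the zero object and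
  \<open>Some x\<close> is the point \<open>x\<close>. Morphisms are elements of the free module on all classes of paths,
  the Hom-sets being cut out by the support.\<close>

type_synonym ('a, 'k) lin_path = "(real \<Rightarrow> 'a) set \<Rightarrow>\<^sub>0 'k"

definition path_class :: "'a triple \<Rightarrow> (real \<Rightarrow> 'a) \<Rightarrow> (real \<Rightarrow> 'a) set" where
  "path_class T \<gamma> = path_rel T `` {\<gamma>}"

definition paths_between :: "'a triple \<Rightarrow> 'a option \<Rightarrow> 'a option \<Rightarrow> (real \<Rightarrow> 'a) set" where
  "paths_between T x y = {\<gamma> \<in> paths T. Some (\<gamma> 0) = x \<and> Some (\<gamma> 1) = y}"

definition scaled_path :: "'a triple \<Rightarrow> 'k::zero \<Rightarrow> (real \<Rightarrow> 'a) \<Rightarrow> ('a, 'k) lin_path" where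
  "scaled_path T c \<gamma> = Poly_Mapping.single (path_class T \<gamma>) c"

definition path_mor :: "'a triple \<Rightarrow> (real \<Rightarrow> 'a) \<Rightarrow> ('a, 'k::{comm_ring,comm_monoid_mult}) lin_path" where
  "path_mor T \<gamma> = scaled_path T 1 \<gamma>"

text \<open>The class of \<open>\<gamma> \<bullet>\<^sub>p \<delta>\<close> for representatives \<open>\<gamma>\<close>, \<open>\<delta>\<close> of composable classes; all the sets in
  the union coincide.\<close>

definition class_concat ::
  "'a triple \<Rightarrow> (real \<Rightarrow> 'a) set \<Rightarrow> (real \<Rightarrow> 'a) set \<Rightarrow> (real \<Rightarrow> 'a) set" where
  "class_concat T c d = (\<Union>\<gamma>\<in>c. \<Union>\<delta>\<in>d. path_class T (\<gamma> \<bullet>\<^sub>p \<delta>))"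

definition lin_path_comp ::
  "'a triple \<Rightarrow> ('a, 'k::{comm_ring,comm_monoid_mult}) lin_path \<Rightarrow> ('a, 'k) lin_path \<Rightarrow> ('a, 'k) lin_path" where
  "lin_path_comp T g f =
     (\<Sum>c\<in>Poly_Mapping.keys f. \<Sum>d\<in>Poly_Mapping.keys g.
        Poly_Mapping.single (class_concat T c d) (Poly_Mapping.lookup g d * Poly_Mapping.lookup f c))"

definition path_category ::
  "'a triple \<Rightarrow> ('a option, ('a, 'k::{comm_ring,comm_monoid_mult}) lin_path) category" where
  "path_category T =
     \<lparr>Obj = insert None (Some ` points T),
      Hom = (\<lambda>x y. {f. Poly_Mapping.keys f \<subseteq> path_class T ` paths_between T x y}),
      Comp = (\<lambda>_ _ _ g f. lin_path_comp T g f),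
      Ident = (\<lambda>x. case x of None \<Rightarrow> 0 | Some p \<Rightarrow> path_mor T (const_path p))\<rparr>"

definition zero_divisor :: "'k::{comm_ring,comm_monoid_mult} \<Rightarrow> bool" where
  "zero_divisor c \<longleftrightarrow> (\<exists>d. d \<noteq> 0 \<and> c * d = 0)"

definition path_sum ::
  "'a triple \<Rightarrow> 'a option \<Rightarrow> 'a option \<Rightarrow> ('a, 'k::{comm_ring,comm_monoid_mult}) lin_path \<Rightarrow> bool" where
  "path_sum T x y f \<longleftrightarrow>
     (\<exists>m cs \<gamma>s. (\<forall>i<m. \<gamma>s i \<in> paths_between T x y \<and> \<not> zero_divisor (cs i)) \<and>
        f = (\<Sum>i<(m::nat). scaled_path T (cs i) (\<gamma>s i)))"

definition path_based_ideal ::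
  "'a triple \<Rightarrow> ('a option \<Rightarrow> 'a option \<Rightarrow> ('a, 'k::{comm_ring,comm_monoid_mult}) lin_path set) \<Rightarrow> bool" where
  "path_based_ideal T I \<longleftrightarrow>
     is_ideal (path_category T) I \<and>
     (\<exists>S. (\<forall>x y. \<forall>f\<in>S x y. path_sum T x y f) \<and>
        (\<forall>x\<in>Obj (path_category T :: ('a option, ('a, 'k) lin_path) category).
         \<forall>y\<in>Obj (path_category T :: ('a option, ('a, 'k) lin_path) category).
           I x y = ideal_generated (path_category T) S x y))"


section \<open>Completion of an ideal along a screen, and the class of morphisms to be inverted\<close>

definition screen_equiv_paths ::
  "'a triple \<Rightarrow> 'a set set \<Rightarrow> (real \<Rightarrow> 'a) \<Rightarrow> (real \<Rightarrow> 'a) \<Rightarrow> bool" where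
  "screen_equiv_paths T P \<gamma> \<gamma>' \<longleftrightarrow>
     (\<exists>\<rho>\<^sub>1\<in>paths T. \<exists>\<rho>\<^sub>2\<in>paths T. \<exists>\<rho>\<^sub>3\<in>paths T. \<exists>\<rho>\<^sub>4\<in>paths T.
        in_pixel P (im \<rho>\<^sub>1 \<union> im \<rho>\<^sub>2) \<and> in_pixel P (im \<rho>\<^sub>3 \<union> im \<rho>\<^sub>4) \<and>
        composable \<rho>\<^sub>1 \<gamma> \<and> composable \<gamma> \<rho>\<^sub>3 \<and> composable \<rho>\<^sub>2 \<gamma>' \<and> composable \<gamma>' \<rho>\<^sub>4 \<and>
        path_equiv T (\<rho>\<^sub>1 \<bullet>\<^sub>p \<gamma> \<bullet>\<^sub>p \<rho>\<^sub>3) (\<rho>\<^sub>2 \<bullet>\<^sub>p \<gamma>' \<bullet>\<^sub>p \<rho>\<^sub>4))"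

text \<open>Equivalence of \<open>f : x \<rightarrow> y\<close> and \<open>g : x' \<rightarrow> y'\<close>.\<close>

definition screen_equiv_mors ::
  "'a triple \<Rightarrow> 'a set set \<Rightarrow>
   'a option \<Rightarrow> 'a option \<Rightarrow> ('a, 'k::{comm_ring,comm_monoid_mult}) lin_path \<Rightarrow>
   'a option \<Rightarrow> 'a option \<Rightarrow> ('a, 'k) lin_path \<Rightarrow> bool" where
  "screen_equiv_mors T P x y f x' y' g \<longleftrightarrow>
     (\<exists>m cs \<gamma>s cs' \<gamma>s' \<pi>.
        (\<forall>i<m. \<gamma>s i \<in> paths_between T x y \<and> \<gamma>s' i \<in> paths_between T x' y') \<and>
        f = (\<Sum>i<(m::nat). scaled_path T (cs i) (\<gamma>s i)) \<and>
        g = (\<Sum>i<m. scaled_path T (cs' i) (\<gamma>s' i)) \<and>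
        \<pi> permutes {..<m} \<and>
        (\<forall>i<m. cs i = cs' (\<pi> i) \<and> screen_equiv_paths T P (\<gamma>s i) (\<gamma>s' (\<pi> i))))"

definition screen_completion ::
  "'a triple \<Rightarrow> 'a set set \<Rightarrow>
   ('a option \<Rightarrow> 'a option \<Rightarrow> ('a, 'k::{comm_ring,comm_monoid_mult}) lin_path set) \<Rightarrow>
   'a option \<Rightarrow> 'a option \<Rightarrow> ('a, 'k) lin_path set" where
  "screen_completion T P I =
     (let C = (path_category T :: ('a option, ('a, 'k) lin_path) category) in
      ideal_generated C
        (\<lambda>x y. {f \<in> Hom C x y. \<exists>x'\<in>Obj C. \<exists>y'\<in>Obj C. \<exists>g\<in>I x' y'. screen_equiv_mors T P x y f x' y' g}))"

text \<open>The residue class of \<open>[\<rho>]\<close> as a morphism of the quotient of the path category by \<open>I\<close>.\<close>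

definition path_residue ::
  "'a triple \<Rightarrow> ('a option \<Rightarrow> 'a option \<Rightarrow> ('a, 'k::{comm_ring,comm_monoid_mult}) lin_path set) \<Rightarrow>
   (real \<Rightarrow> 'a) \<Rightarrow> ('a, 'k) lin_path set" where
  "path_residue T I \<rho> = residue_class I (Some (\<rho> 0)) (Some (\<rho> 1)) (path_mor T \<rho>)"

definition pre_dead ::
  "'a triple \<Rightarrow> ('a option \<Rightarrow> 'a option \<Rightarrow> ('a, 'k::{comm_ring,comm_monoid_mult}) lin_path set) \<Rightarrow>
   'a set \<Rightarrow> bool" where
  "pre_dead T I X \<longleftrightarrow>
     (\<exists>\<rho>\<in>paths T. im \<rho> \<subseteq> X \<and> path_residue T I \<rho> = residue_class I (Some (\<rho> 0)) (Some (\<rho> 1)) 0)"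

text \<open>The last set of the union adds the identity of the zero object.\<close>

definition screen_sigma ::
  "'a triple \<Rightarrow> 'a set set \<Rightarrow>
   ('a option \<Rightarrow> 'a option \<Rightarrow> ('a, 'k::{comm_ring,comm_monoid_mult}) lin_path set) \<Rightarrow>
   'a option \<Rightarrow> 'a option \<Rightarrow> ('a, 'k) lin_path set set" where
  "screen_sigma T P I x y =
     (let K = screen_completion T P I in
        {path_residue T K \<rho> | \<rho>. \<rho> \<in> paths_between T x y \<and> in_pixel P (im \<rho>) \<and>
           path_residue T K \<rho> \<noteq> residue_class K x y 0} \<union>
        {residue_class K x y 0 | X. X \<in> P \<and> pre_dead T I X \<and> x \<in> Some ` X \<and> y \<in> Some ` X} \<union>
        (if x = None \<and> y = None then {residue_class K x y (Ident (path_category T) None)} else {}))"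

end

theory Submission
  imports Defs
begin

text \<open>
  Condition (S3) says that the morphisms given by paths inside a pixel satisfy both Ore conditions
  in the path category. Consequently the morphisms \<open>f\<close> for which \<open>\<tau> \<circ> f \<circ> \<sigma>\<close> lies in the ideal, for
  some pixel morphisms \<open>\<sigma>\<close> and \<open>\<tau>\<close>, form an ideal. By (S2) and (S3) a pixel is directed in both
  directions, and by (S1) parallel paths in it are equivalent; hence this ideal is exactly the
  completion along the screen. Modulo the completion, pixel morphisms can therefore be cancelled on
  both sides, while the Ore squares descend from the path category. The remaining elements of the
  class are zero morphisms, and a pixel is pre-dead precisely when its points become zero objects of
  the quotient, where the conditions are trivial. The left-handed and right-handed conditions are
  exchanged by passing to the opposite category.
\<close>

section \<open>Ideals saturated along an Ore class\<close>

text \<open>(S3) supplies squares for single paths, while conditions (2) and (4) concern linear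
  combinations. The squares found for two summands have different denominators. One more Ore square,
  between the two denominators, makes them equal; denominators are single paths inside pixels, so
  (S3) applies to them directly and the argument is not circular. The completion shows a similar
  mismatch: each summand of a sum may use its own four witness paths, but membership in the
  saturation asks for one pair \<sigma>, \<tau> serving the whole sum. A last difficulty is that the
  class to be inverted refers to two ideals: a pixel morphism must be nonzero modulo the completion,
  whereas pre-deadness is tested modulo \<open>I\<close>. The two tests fit together because a pixel
  path that vanishes modulo the completion can be prolonged at both ends, inside its pixel, to a
  path whose class lies in \<open>I\<close> itself. This is also why the class is closed under
  composition although composites of nonzero morphisms may vanish.\<close>

definition opposite :: "('o, 'm) category \<Rightarrow> ('o, 'm) category" where
  "opposite C = \<lparr>Obj = Obj C, Hom = (\<lambda>x y. Hom C y x), Comp = (\<lambda>x y z g f. Comp C z y x f g),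
     Ident = Ident C\<rparr>"

lemma opposite_simps [simp]:
  "Obj (opposite C) = Obj C" "Hom (opposite C) x y = Hom C y x"
  "Comp (opposite C) x y z g f = Comp C z y x f g" "Ident (opposite C) = Ident C"
  by (simp_all add: opposite_def)

section \<open>Additive structure and Ore squares\<close>

locale preadditive_category =
  fixes C :: "('o, 'm::ab_group_add) category"
  assumes category: "is_category C"
    and zero_in: "\<lbrakk>x \<in> Obj C; y \<in> Obj C\<rbrakk> \<Longrightarrow> 0 \<in> Hom C x y"
    and add_in: "\<lbrakk>x \<in> Obj C; y \<in> Obj C; f \<in> Hom C x y; g \<in> Hom C x y\<rbrakk> \<Longrightarrow> f + g \<in> Hom C x y"
    and minus_in: "\<lbrakk>x \<in> Obj C; y \<in> Obj C; f \<in> Hom C x y\<rbrakk> \<Longrightarrow> - f \<in> Hom C x y"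
    and comp_add_left: "\<lbrakk>x \<in> Obj C; y \<in> Obj C; z \<in> Obj C; f \<in> Hom C x y; g \<in> Hom C y z; g' \<in> Hom C y z\<rbrakk>
      \<Longrightarrow> Comp C x y z (g + g') f = Comp C x y z g f + Comp C x y z g' f"
    and comp_add_right: "\<lbrakk>x \<in> Obj C; y \<in> Obj C; z \<in> Obj C; f \<in> Hom C x y; f' \<in> Hom C x y; g \<in> Hom C y z\<rbrakk>
      \<Longrightarrow> Comp C x y z g (f + f') = Comp C x y z g f + Comp C x y z g f'"
begin

lemma ident_in: "x \<in> Obj C \<Longrightarrow> Ident C x \<in> Hom C x x"
  using category by (simp add: is_category_def)

lemma comp_in:
  "\<lbrakk>x \<in> Obj C; y \<in> Obj C; z \<in> Obj C; f \<in> Hom C x y; g \<in> Hom C y z\<rbrakk> \<Longrightarrow> Comp C x y z g f \<in> Hom C x z"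
  using category by (simp add: is_category_def)

lemma comp_ident_right: "\<lbrakk>x \<in> Obj C; y \<in> Obj C; f \<in> Hom C x y\<rbrakk> \<Longrightarrow> Comp C x x y f (Ident C x) = f"
  using category by (simp add: is_category_def)

lemma comp_ident_left: "\<lbrakk>x \<in> Obj C; y \<in> Obj C; f \<in> Hom C x y\<rbrakk> \<Longrightarrow> Comp C x y y (Ident C y) f = f"
  using category by (simp add: is_category_def)

lemma comp_assoc:
  "\<lbrakk>w \<in> Obj C; x \<in> Obj C; y \<in> Obj C; z \<in> Obj C; f \<in> Hom C w x; g \<in> Hom C x y; h \<in> Hom C y z\<rbrakk>
    \<Longrightarrow> Comp C w x z (Comp C x y z h g) f = Comp C w y z h (Comp C w x y g f)"
  using category by (simp add: is_category_def)

lemma preadditive_opposite: "preadditive_category (opposite C)"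
proof
  show "is_category (opposite C)"
    using category unfolding is_category_def by simp
qed (simp_all add: zero_in add_in minus_in comp_add_left comp_add_right)

lemma diff_in: "\<lbrakk>x \<in> Obj C; y \<in> Obj C; f \<in> Hom C x y; g \<in> Hom C x y\<rbrakk> \<Longrightarrow> f - g \<in> Hom C x y"
  using add_in[of x y f "- g"] minus_in[of x y g] by simp

lemma comp_zero_left: "\<lbrakk>x \<in> Obj C; y \<in> Obj C; z \<in> Obj C; f \<in> Hom C x y\<rbrakk> \<Longrightarrow> Comp C x y z 0 f = 0"
  using comp_add_left[of x y z f 0 0] zero_in by simp

lemma comp_diff_left:
  assumes "x \<in> Obj C" "y \<in> Obj C" "z \<in> Obj C" "f \<in> Hom C x y" "g \<in> Hom C y z" "g' \<in> Hom C y z"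
  shows "Comp C x y z (g - g') f = Comp C x y z g f - Comp C x y z g' f"
  using comp_add_left[of x y z f "g - g'" g'] assms diff_in by (simp add: algebra_simps)

text \<open>The conclusion of condition (2) for one pair. The class is a parameter, so the notion is
  available for the reversed class in the opposite category and before any Ore property has been
  established.\<close>

definition ore_square :: "('o \<Rightarrow> 'o \<Rightarrow> 'm set) \<Rightarrow> 'o \<Rightarrow> 'o \<Rightarrow> 'o \<Rightarrow> 'm \<Rightarrow> 'm \<Rightarrow> bool" where
  "ore_square W x x' y \<sigma> f \<longleftrightarrow>
     (\<exists>y'\<in>Obj C. \<exists>\<tau>\<in>W y y'. \<exists>f'\<in>Hom C x' y'. Comp C x x' y' f' \<sigma> = Comp C x y y' \<tau> f)"

text \<open>The two given squares are brought to the common denominator \<tau>\<tau>2 = h\<tau>1,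
  obtained from the Ore property for the pair \<tau>1, \<tau>2. Asking for that property only
  between members of \<open>W\<close> lets this lemma serve to prove the Ore property for
  sums.\<close>

lemma ore_square_add:
  assumes W: "\<And>x y. x \<in> Obj C \<Longrightarrow> y \<in> Obj C \<Longrightarrow> W x y \<subseteq> Hom C x y"
    and W_comp: "\<And>x y z \<sigma> \<tau>. \<lbrakk>x \<in> Obj C; y \<in> Obj C; z \<in> Obj C; \<sigma> \<in> W x y; \<tau> \<in> W y z\<rbrakk>
      \<Longrightarrow> Comp C x y z \<tau> \<sigma> \<in> W x z"
    and W_ore: "\<And>x x' y \<sigma> \<tau>. \<lbrakk>x \<in> Obj C; x' \<in> Obj C; y \<in> Obj C; \<sigma> \<in> W x x'; \<tau> \<in> W x y\<rbrakk>
      \<Longrightarrow> ore_square W x x' y \<sigma> \<tau>"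
    and obj: "x \<in> Obj C" "x' \<in> Obj C" "y \<in> Obj C" and "\<sigma> \<in> W x x'"
    and fg: "f \<in> Hom C x y" "g \<in> Hom C x y"
    and "ore_square W x x' y \<sigma> f" "ore_square W x x' y \<sigma> g"
  shows "ore_square W x x' y \<sigma> (f + g)"
proof -
  have \<sigma>: "\<sigma> \<in> Hom C x x'" using W obj \<open>\<sigma> \<in> W x x'\<close> by blast
  obtain y1 \<tau>1 f' where 1: "y1 \<in> Obj C" "\<tau>1 \<in> W y y1" "f' \<in> Hom C x' y1"
      "Comp C x x' y1 f' \<sigma> = Comp C x y y1 \<tau>1 f"
    using \<open>ore_square W x x' y \<sigma> f\<close> by (auto simp: ore_square_def)
  obtain y2 \<tau>2 g' where 2: "y2 \<in> Obj C" "\<tau>2 \<in> W y y2" "g' \<in> Hom C x' y2"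
      "Comp C x x' y2 g' \<sigma> = Comp C x y y2 \<tau>2 g"
    using \<open>ore_square W x x' y \<sigma> g\<close> by (auto simp: ore_square_def)
  obtain z \<tau> h where z: "z \<in> Obj C" "\<tau> \<in> W y2 z" "h \<in> Hom C y1 z"
      "Comp C y y1 z h \<tau>1 = Comp C y y2 z \<tau> \<tau>2"
    using W_ore[OF obj(3) 1(1) 2(1) 1(2) 2(2)] by (auto simp: ore_square_def)
  have \<tau>: "\<tau>1 \<in> Hom C y y1" "\<tau>2 \<in> Hom C y y2" "\<tau> \<in> Hom C y2 z"
    using W 1 2 z obj by blast+
  define k where "k = Comp C x' y1 z h f' + Comp C x' y2 z \<tau> g'"
  let ?\<tau> = "Comp C y y2 z \<tau> \<tau>2"
  have "Comp C x x' z k \<sigma> = Comp C x y1 z h (Comp C x x' y1 f' \<sigma>) + Comp C x y2 z \<tau> (Comp C x x' y2 g' \<sigma>)"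
    unfolding k_def using obj 1 2 z \<tau> \<sigma> by (simp add: comp_add_left comp_in comp_assoc)
  also have "\<dots> = Comp C x y z (Comp C y y1 z h \<tau>1) f + Comp C x y z ?\<tau> g"
    unfolding 1(4) 2(4) using obj 1(1-3) 2(1-3) z(1-3) \<tau> fg by (simp add: comp_assoc)
  also have "\<dots> = Comp C x y z ?\<tau> (f + g)"
    unfolding z(4) using obj 1 2 z(1-3) \<tau> fg by (simp add: comp_add_right comp_in)
  finally have "Comp C x x' z k \<sigma> = Comp C x y z ?\<tau> (f + g)" .
  moreover have "k \<in> Hom C x' z" "?\<tau> \<in> W y z"
    unfolding k_def using obj 1 2 z \<tau> by (simp_all add: add_in comp_in W_comp)
  ultimately show ?thesis
    using z(1) by (auto simp: ore_square_def)
qed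

end

section \<open>Ideals and quotient categories\<close>

locale preadditive_ideal = preadditive_category C for C :: "('o, 'm::ab_group_add) category" +
  fixes L :: "'o \<Rightarrow> 'o \<Rightarrow> 'm set"
  assumes ideal: "is_ideal C L"
begin

lemma ideal_sub: "\<lbrakk>x \<in> Obj C; y \<in> Obj C; f \<in> L x y\<rbrakk> \<Longrightarrow> f \<in> Hom C x y"
  and ideal_zero: "\<lbrakk>x \<in> Obj C; y \<in> Obj C\<rbrakk> \<Longrightarrow> 0 \<in> L x y"
  and ideal_add: "\<lbrakk>x \<in> Obj C; y \<in> Obj C; f \<in> L x y; g \<in> L x y\<rbrakk> \<Longrightarrow> f + g \<in> L x y"
  and ideal_minus: "\<lbrakk>x \<in> Obj C; y \<in> Obj C; f \<in> L x y\<rbrakk> \<Longrightarrow> - f \<in> L x y"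
  and ideal_comp_left: "\<lbrakk>x \<in> Obj C; y \<in> Obj C; z \<in> Obj C; f \<in> L x y; g \<in> Hom C y z\<rbrakk> \<Longrightarrow> Comp C x y z g f \<in> L x z"
  and ideal_comp_right: "\<lbrakk>x \<in> Obj C; y \<in> Obj C; z \<in> Obj C; f \<in> Hom C x y; g \<in> L y z\<rbrakk> \<Longrightarrow> Comp C x y z g f \<in> L x z"
  using ideal unfolding is_ideal_def by (simp_all add: subset_iff)

lemma ideal_diff: "\<lbrakk>x \<in> Obj C; y \<in> Obj C; f \<in> L x y; g \<in> L x y\<rbrakk> \<Longrightarrow> f - g \<in> L x y"
  using ideal_add[of x y f "- g"] ideal_minus[of x y g] by simp

lemma residue_class_eq_iff:
  assumes "x \<in> Obj C" "y \<in> Obj C"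
  shows "residue_class L x y f = residue_class L x y g \<longleftrightarrow> f - g \<in> L x y"
proof
  assume "residue_class L x y f = residue_class L x y g"
  then have "f + 0 \<in> residue_class L x y g"
    using assms ideal_zero unfolding residue_class_def by blast
  then show "f - g \<in> L x y" by (auto simp: residue_class_def)
next
  assume d: "f - g \<in> L x y"
  show "residue_class L x y f = residue_class L x y g"
  proof (intro set_eqI iffI)
    fix u assume "u \<in> residue_class L x y f"
    then obtain h where "h \<in> L x y" "u = f + h" by (auto simp: residue_class_def)
    then show "u \<in> residue_class L x y g" unfolding residue_class_def
      using ideal_add[OF assms d, of h] by (auto intro!: image_eqI[where x = "f - g + h"])
  next
    fix u assume "u \<in> residue_class L x y g"
    then obtain h where "h \<in> L x y" "u = g + h" by (auto simp: residue_class_def)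
    then show "u \<in> residue_class L x y f" unfolding residue_class_def
      using ideal_diff[OF assms _ d, of h] by (auto intro!: image_eqI[where x = "h - (f - g)"])
  qed
qed

lemma residue_class_eq_0_iff:
  "\<lbrakk>x \<in> Obj C; y \<in> Obj C\<rbrakk> \<Longrightarrow> residue_class L x y f = residue_class L x y 0 \<longleftrightarrow> f \<in> L x y"
  using residue_class_eq_iff[of x y f 0] by simp

text \<open>Composition in the quotient is a union over all pairs of representatives. Changing
  representatives by \<open>h\<close> and \<open>k\<close> adds gk + hf + hk, which lies in the
  ideal, so all members of the union agree.\<close>

lemma quotient_comp:
  assumes obj: "x \<in> Obj C" "y \<in> Obj C" "z \<in> Obj C" and f: "f \<in> Hom C x y" and g: "g \<in> Hom C y z"
  shows "Comp (quotient_category C L) x y z (residue_class L y z g) (residue_class L x y f) =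
    residue_class L x z (Comp C x y z g f)"
proof -
  have "residue_class L x z (Comp C x y z (g + h) (f + k)) = residue_class L x z (Comp C x y z g f)"
    if "h \<in> L y z" "k \<in> L x y" for h k
  proof -
    have hk: "h \<in> Hom C y z" "k \<in> Hom C x y" using that obj ideal_sub by auto
    have "Comp C x y z (g + h) (f + k) - Comp C x y z g f =
        Comp C x y z g k + (Comp C x y z h f + Comp C x y z h k)"
      using obj f g hk by (simp add: comp_add_left comp_add_right add_in)
    also have "\<dots> \<in> L x z"
      using obj f g hk that by (intro ideal_add ideal_comp_left[of x y z] ideal_comp_right[of x y z]) auto
    finally show ?thesis using obj by (simp add: residue_class_eq_iff)
  qed
  \<comment> \<open>Nonempty classes are what turn a union of equal sets into their common
    value.\<close>
  moreover have "0 \<in> L y z" "0 \<in> L x y" using obj ideal_zero by auto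
  ultimately show ?thesis
    by (auto simp: quotient_category_def residue_class_def[of L y z g] residue_class_def[of L x y f])
qed

lemma quotient_simps [simp]:
  "Obj (quotient_category C L) = Obj C"
  "Hom (quotient_category C L) x y = residue_class L x y ` Hom C x y"
  "Ident (quotient_category C L) x = residue_class L x x (Ident C x)"
  by (simp_all add: quotient_category_def)

lemma quotient_is_category: "is_category (quotient_category C L)"
  unfolding is_category_def
  by (auto simp: quotient_comp ident_in comp_in comp_ident_left comp_ident_right comp_assoc)

lemma ideal_opposite: "preadditive_ideal (opposite C) (\<lambda>x y. L y x)"
  using preadditive_opposite ideal
  by (auto simp: preadditive_ideal_def preadditive_ideal_axioms_def is_ideal_def)

text \<open>Being an ideal constrains a family only at objects. This matters because the completion
  and the saturation are compared only there.\<close>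

lemma ideal_cong:
  assumes "\<And>x y. \<lbrakk>x \<in> Obj C; y \<in> Obj C\<rbrakk> \<Longrightarrow> M x y = L x y"
  shows "preadditive_ideal C M"
  using preadditive_category_axioms ideal assms
  by (simp add: preadditive_ideal_def preadditive_ideal_axioms_def is_ideal_def)

text \<open>An equality of records, so statements about the quotient of the opposite category become
  dual statements about the quotient by rewriting.\<close>

lemma quotient_opposite:
  "quotient_category (opposite C) (\<lambda>x y. L y x) = opposite (quotient_category C L)"
  by (auto simp: quotient_category_def opposite_def residue_class_def intro!: ext)

end

section \<open>The saturation and its closure properties\<close>

locale ore_class = preadditive_ideal C I for C :: "('o, 'm::ab_group_add) category" and I +
  fixes W :: "'o \<Rightarrow> 'o \<Rightarrow> 'm set"
  assumes W_sub: "\<lbrakk>x \<in> Obj C; y \<in> Obj C; f \<in> W x y\<rbrakk> \<Longrightarrow> f \<in> Hom C x y"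
    and W_ident: "x \<in> Obj C \<Longrightarrow> Ident C x \<in> W x x"
    and W_comp: "\<lbrakk>x \<in> Obj C; y \<in> Obj C; z \<in> Obj C; \<sigma> \<in> W x y; \<tau> \<in> W y z\<rbrakk> \<Longrightarrow> Comp C x y z \<tau> \<sigma> \<in> W x z"
    and ore: "\<lbrakk>x \<in> Obj C; x' \<in> Obj C; y \<in> Obj C; \<sigma> \<in> W x x'; f \<in> Hom C x y\<rbrakk>
      \<Longrightarrow> ore_square W x x' y \<sigma> f"
    and ore_opposite: "\<lbrakk>x \<in> Obj C; x' \<in> Obj C; y \<in> Obj C; \<sigma> \<in> W x' x; f \<in> Hom C y x\<rbrakk>
      \<Longrightarrow> preadditive_category.ore_square (opposite C) (\<lambda>x y. W y x) x x' y \<sigma> f"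
begin

text \<open>Composites on both sides are allowed because screen equivalence alters both ends of a
  path; the resulting condition is also symmetric under reversal of arrows.\<close>

definition saturation :: "'o \<Rightarrow> 'o \<Rightarrow> 'm set" where
  "saturation x y = {f \<in> Hom C x y. \<exists>w\<in>Obj C. \<exists>z\<in>Obj C. \<exists>\<sigma>\<in>W w x. \<exists>\<tau>\<in>W y z.
     Comp C w y z \<tau> (Comp C w x y f \<sigma>) \<in> I w z}"

lemma saturationI:
  "\<lbrakk>f \<in> Hom C x y; w \<in> Obj C; z \<in> Obj C; \<sigma> \<in> W w x; \<tau> \<in> W y z;
     Comp C w y z \<tau> (Comp C w x y f \<sigma>) \<in> I w z\<rbrakk> \<Longrightarrow> f \<in> saturation x y"
  unfolding saturation_def by blast

lemma saturationE:
  assumes "f \<in> saturation x y"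
  obtains w z \<sigma> \<tau> where "f \<in> Hom C x y" "w \<in> Obj C" "z \<in> Obj C" "\<sigma> \<in> W w x" "\<tau> \<in> W y z"
    "Comp C w y z \<tau> (Comp C w x y f \<sigma>) \<in> I w z"
  using assms unfolding saturation_def by blast

lemma oreE:
  assumes "x \<in> Obj C" "x' \<in> Obj C" "y \<in> Obj C" "\<sigma> \<in> W x x'" "f \<in> Hom C x y"
  obtains y' \<tau> f' where "y' \<in> Obj C" "\<tau> \<in> W y y'" "f' \<in> Hom C x' y'"
    "Comp C x x' y' f' \<sigma> = Comp C x y y' \<tau> f"
  using ore[OF assms] by (auto simp: ore_square_def)

lemma ore_class_opposite: "ore_class (opposite C) (\<lambda>x y. I y x) (\<lambda>x y. W y x)"
proof -
  interpret op: preadditive_ideal "opposite C" "\<lambda>x y. I y x" by (rule ideal_opposite)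
  interpret opop: preadditive_ideal "opposite (opposite C)" "\<lambda>x y. I x y" by (rule op.ideal_opposite)
  show ?thesis
  proof
    fix x x' y \<sigma> f
    assume "x \<in> Obj (opposite C)" "x' \<in> Obj (opposite C)" "y \<in> Obj (opposite C)" "\<sigma> \<in> W x x'"
      "f \<in> Hom (opposite C) y x"
    \<comment> \<open>After unfolding, a square in the double opposite is literally a square in
      \<open>C\<close>.\<close>
    then show "opop.ore_square W x x' y \<sigma> f"
      using ore by (simp add: ore_square_def opop.ore_square_def)
  qed (use W_sub W_ident W_comp ore_opposite in auto)
qed

text \<open>The opposite category brackets the threefold composite the other way round, so the
  comparison is associativity.\<close>

lemma saturation_opposite:
  assumes "x \<in> Obj C" "y \<in> Obj C"
  shows "ore_class.saturation (opposite C) (\<lambda>x y. I y x) (\<lambda>x y. W y x) x y = saturation y x"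
proof -
  interpret op: ore_class "opposite C" "\<lambda>x y. I y x" "\<lambda>x y. W y x" by (rule ore_class_opposite)
  have "Comp C w x z \<tau> (Comp C w y x f \<sigma>) = Comp C w y z (Comp C y x z \<tau> f) \<sigma>"
    if "f \<in> Hom C y x" "w \<in> Obj C" "z \<in> Obj C" "\<sigma> \<in> W w y" "\<tau> \<in> W x z" for f w z \<sigma> \<tau>
    using comp_assoc[of w y x z \<sigma> f \<tau>] that assms W_sub by auto
  then show ?thesis
    unfolding saturation_def op.saturation_def
    by (intro Collect_cong conj_cong) (simp_all cong: bex_cong, blast)
qed

text \<open>An Ore square g'\<tau> = \<tau>'g moves the denominator past \<open>g\<close>: then
  \<tau>'(gf)\<sigma> = g'(\<tau>f\<sigma>), which is in \<open>I\<close>.\<close>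

lemma saturation_comp_left:
  assumes obj: "x \<in> Obj C" "y \<in> Obj C" "v \<in> Obj C" and "f \<in> saturation x y" and g: "g \<in> Hom C y v"
  shows "Comp C x y v g f \<in> saturation x v"
proof -
  from \<open>f \<in> saturation x y\<close> obtain w z \<sigma> \<tau> where f: "f \<in> Hom C x y" "w \<in> Obj C" "z \<in> Obj C"
      "\<sigma> \<in> W w x" "\<tau> \<in> W y z" "Comp C w y z \<tau> (Comp C w x y f \<sigma>) \<in> I w z"
    by (rule saturationE)
  obtain v' \<tau>' g' where v: "v' \<in> Obj C" "\<tau>' \<in> W v v'" "g' \<in> Hom C z v'"
      "Comp C y z v' g' \<tau> = Comp C y v v' \<tau>' g"
    using oreE[OF obj(2) f(3) obj(3) f(5) g] .
  have hom: "\<sigma> \<in> Hom C w x" "\<tau> \<in> Hom C y z" "\<tau>' \<in> Hom C v v'" using obj f v W_sub by auto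
  have "Comp C w v v' \<tau>' (Comp C w x v (Comp C x y v g f) \<sigma>) =
      Comp C w y v' (Comp C y v v' \<tau>' g) (Comp C w x y f \<sigma>)"
    using obj f g v hom by (simp add: comp_assoc comp_in)
  also have "\<dots> = Comp C w z v' g' (Comp C w y z \<tau> (Comp C w x y f \<sigma>))"
    unfolding v(4)[symmetric] using obj f g v(1-3) hom by (simp add: comp_assoc comp_in)
  also have "\<dots> \<in> I w v'" using f v by (intro ideal_comp_left[of w z v']) auto
  finally show ?thesis
    using obj f g v by (intro saturationI[of _ x v w v' \<sigma> \<tau>']) (auto intro: comp_in)
qed

text \<open>Common denominators are found at both ends: h\<tau>1 = \<tau>\<tau>2 and \<sigma>1k =
  \<sigma>2\<sigma>. The composite with \<open>f\<close> is rewritten through \<open>h\<close> and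
  \<open>k\<close>, the one with \<open>g\<close> through \<tau> and \<sigma>; here \<open>h\<close>
  and \<open>k\<close> are arbitrary morphisms, which the ideal \<open>I\<close> absorbs.\<close>

lemma saturation_add:
  assumes obj: "x \<in> Obj C" "y \<in> Obj C" and "f \<in> saturation x y" "g \<in> saturation x y"
  shows "f + g \<in> saturation x y"
proof -
  interpret op: ore_class "opposite C" "\<lambda>x y. I y x" "\<lambda>x y. W y x" by (rule ore_class_opposite)
  from \<open>f \<in> saturation x y\<close> obtain w1 z1 \<sigma>1 \<tau>1 where f: "f \<in> Hom C x y" "w1 \<in> Obj C" "z1 \<in> Obj C"
      "\<sigma>1 \<in> W w1 x" "\<tau>1 \<in> W y z1" "Comp C w1 y z1 \<tau>1 (Comp C w1 x y f \<sigma>1) \<in> I w1 z1"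
    by (rule saturationE)
  from \<open>g \<in> saturation x y\<close> obtain w2 z2 \<sigma>2 \<tau>2 where g: "g \<in> Hom C x y" "w2 \<in> Obj C" "z2 \<in> Obj C"
      "\<sigma>2 \<in> W w2 x" "\<tau>2 \<in> W y z2" "Comp C w2 y z2 \<tau>2 (Comp C w2 x y g \<sigma>2) \<in> I w2 z2"
    by (rule saturationE)
  have hom: "\<sigma>1 \<in> Hom C w1 x" "\<tau>1 \<in> Hom C y z1" "\<sigma>2 \<in> Hom C w2 x" "\<tau>2 \<in> Hom C y z2"
    using obj f g W_sub by auto
  obtain z \<tau> h where z: "z \<in> Obj C" "\<tau> \<in> W z2 z" "h \<in> Hom C z1 z"
      "Comp C y z1 z h \<tau>1 = Comp C y z2 z \<tau> \<tau>2"
    using oreE[OF obj(2) f(3) g(3) f(5) hom(4)] .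
  obtain w \<sigma> k where w: "w \<in> Obj C" "\<sigma> \<in> W w w2" "k \<in> Hom C w w1"
      "Comp C w w1 x \<sigma>1 k = Comp C w w2 x \<sigma>2 \<sigma>"
    using op.oreE[of x w1 w2 \<sigma>1 \<sigma>2] obj f g hom by auto
  have hom': "\<sigma> \<in> Hom C w w2" "\<tau> \<in> Hom C z2 z" using f g z w W_sub by auto
  define \<sigma>' where "\<sigma>' = Comp C w w2 x \<sigma>2 \<sigma>"
  define \<tau>' where "\<tau>' = Comp C y z2 z \<tau> \<tau>2"
  have W': "\<sigma>' \<in> W w x" "\<tau>' \<in> W y z"
    unfolding \<sigma>'_def \<tau>'_def using obj f g z w by (auto intro: W_comp)
  have hom'': "\<sigma>' \<in> Hom C w x" "\<tau>' \<in> Hom C y z"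
    using W' obj w z W_sub by auto
  have "Comp C w y z \<tau>' (Comp C w x y f \<sigma>') =
      Comp C w z1 z h (Comp C w w1 z1 (Comp C w1 y z1 \<tau>1 (Comp C w1 x y f \<sigma>1)) k)"
    unfolding \<sigma>'_def \<tau>'_def z(4)[symmetric] w(4)[symmetric]
    using obj f(1-5) g(1-5) z(1-3) w(1-3) hom by (simp add: comp_assoc comp_in)
  also have "\<dots> \<in> I w z"
    using f g z w by (intro ideal_comp_left[of _ z1] ideal_comp_right[of _ w1]) auto
  finally have fI: "Comp C w y z \<tau>' (Comp C w x y f \<sigma>') \<in> I w z" .
  have "Comp C w y z \<tau>' (Comp C w x y g \<sigma>') =
      Comp C w z2 z \<tau> (Comp C w w2 z2 (Comp C w2 y z2 \<tau>2 (Comp C w2 x y g \<sigma>2)) \<sigma>)"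
    unfolding \<sigma>'_def \<tau>'_def
    using obj f(1-5) g(1-5) z(1-3) w(1-3) hom hom' by (simp add: comp_assoc comp_in)
  also have "\<dots> \<in> I w z"
    using f g z w hom' by (intro ideal_comp_left[of _ z2] ideal_comp_right[of _ w2]) auto
  finally have "Comp C w y z \<tau>' (Comp C w x y g \<sigma>') \<in> I w z" .
  then have "Comp C w y z \<tau>' (Comp C w x y (f + g) \<sigma>') \<in> I w z"
    using fI obj f g z w hom'' ideal_add by (simp add: comp_add_left comp_add_right comp_in)
  then show ?thesis
    using obj f g z w W' by (intro saturationI[of _ x y w z \<sigma>' \<tau>']) (auto intro: add_in)
qed

lemma ideal_subset_saturation:
  assumes "x \<in> Obj C" "y \<in> Obj C" "f \<in> I x y"
  shows "f \<in> saturation x y"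
  using assms ideal_sub[OF assms]
  by (intro saturationI[of f x y x y "Ident C x" "Ident C y"])
    (auto simp: W_ident comp_ident_left comp_ident_right)

lemma saturation_ideal: "preadditive_ideal C saturation"
proof
  interpret op: ore_class "opposite C" "\<lambda>x y. I y x" "\<lambda>x y. W y x" by (rule ore_class_opposite)
  have minus: "- f \<in> saturation x y" if obj: "x \<in> Obj C" "y \<in> Obj C" and "f \<in> saturation x y" for x y f
  proof -
    have f: "f \<in> Hom C x y" using that by (auto elim: saturationE)
    \<comment> \<open>Negation is composition with minus the identity, so it is covered by closure
      under composition.\<close>
    have "- Ident C y \<in> Hom C y y" using obj by (simp add: minus_in ident_in)
    then have "Comp C x y y (- Ident C y) f \<in> saturation x y"
      using that saturation_comp_left by auto
    moreover have "Comp C x y y (- Ident C y) f = - f"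
      using comp_diff_left[of x y y f 0 "Ident C y"] obj f
      by (simp add: zero_in ident_in comp_zero_left comp_ident_left)
    ultimately show ?thesis by simp
  qed
  show "is_ideal C saturation"
    unfolding is_ideal_def
  proof (intro conjI ballI)
    fix x y z f g assume "x \<in> Obj C" "y \<in> Obj C" "z \<in> Obj C" "f \<in> Hom C x y" "g \<in> saturation y z"
    then show "Comp C x y z g f \<in> saturation x z"
      using op.saturation_comp_left[of z y x g f] by (simp add: saturation_opposite)
  qed (auto simp: saturation_comp_left saturation_add minus ideal_zero ideal_subset_saturation
      elim: saturationE)
qed

end

sublocale ore_class \<subseteq> sat: preadditive_ideal C saturation
  by (rule saturation_ideal)

context ore_class begin

text \<open>The cancelled \<sigma> is absorbed into the witness on the right, since \<open>W\<close>
  is closed under composition.\<close>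

lemma saturation_cancel_right:
  assumes obj: "w \<in> Obj C" "x \<in> Obj C" "y \<in> Obj C" and "\<sigma> \<in> W w x" "f \<in> Hom C x y"
    and "Comp C w x y f \<sigma> \<in> saturation w y"
  shows "f \<in> saturation x y"
proof -
  obtain v z \<rho> \<tau> where v: "v \<in> Obj C" "z \<in> Obj C" "\<rho> \<in> W v w" "\<tau> \<in> W y z"
      "Comp C v y z \<tau> (Comp C v w y (Comp C w x y f \<sigma>) \<rho>) \<in> I v z"
    using assms(6) by (rule saturationE)
  have "\<sigma> \<in> Hom C w x" "\<rho> \<in> Hom C v w" using W_sub v obj assms(4) by auto
  then have "Comp C v y z \<tau> (Comp C v x y f (Comp C v w x \<sigma> \<rho>)) \<in> I v z"
    using v obj assms(5) by (simp add: comp_assoc)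
  then show ?thesis
    using assms v by (intro saturationI[of f x y v z "Comp C v w x \<sigma> \<rho>" \<tau>]) (auto intro: W_comp)
qed

end

text \<open>The condition \<open>Ident C x \<in> L x x\<close> says that \<open>x\<close> becomes a
  zero object modulo \<open>L\<close>. Both ends are required to be null in \<open>S_cases\<close>
  so that the axiom survives reversal. \<open>residue_in_S\<close> includes residues that vanish,
  hence \<open>S\<close> must supply a zero morphism wherever some member of \<open>W\<close>
  dies.\<close>

locale fraction_class = ore_class C I W for C :: "('o, 'm::ab_group_add) category" and I W +
  fixes L :: "'o \<Rightarrow> 'o \<Rightarrow> 'm set" and S :: "'o \<Rightarrow> 'o \<Rightarrow> 'm set set"
  assumes L_eq: "\<lbrakk>x \<in> Obj C; y \<in> Obj C\<rbrakk> \<Longrightarrow> L x y = saturation x y"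
    and S_sub: "\<lbrakk>x \<in> Obj C; y \<in> Obj C\<rbrakk> \<Longrightarrow> S x y \<subseteq> residue_class L x y ` Hom C x y"
    and residue_in_S: "\<lbrakk>x \<in> Obj C; y \<in> Obj C; \<sigma> \<in> W x y\<rbrakk> \<Longrightarrow> residue_class L x y \<sigma> \<in> S x y"
    and S_cases: "\<lbrakk>x \<in> Obj C; y \<in> Obj C; s \<in> S x y\<rbrakk> \<Longrightarrow>
      s \<in> residue_class L x y ` W x y \<or>
      Ident C x \<in> L x x \<and> Ident C y \<in> L y y"
    and S_comp: "\<lbrakk>x \<in> Obj C; y \<in> Obj C; z \<in> Obj C; s \<in> S x y; t \<in> S y z\<rbrakk>
      \<Longrightarrow> Comp (quotient_category C L) x y z t s \<in> S x z"
begin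

sublocale quo: preadditive_ideal C L
  by (rule sat.ideal_cong[OF L_eq])

abbreviation "D \<equiv> quotient_category C L"
abbreviation "cls \<equiv> residue_class L"

lemma null_object_source:
  assumes "x \<in> Obj C" "y \<in> Obj C" "Ident C x \<in> L x x" "f \<in> Hom C x y"
  shows "f \<in> L x y"
  using quo.ideal_comp_left[of x x y "Ident C x" f] assms by (simp add: comp_ident_right)

lemma fraction_ore:
  assumes obj: "x \<in> Obj C" "x' \<in> Obj C" "y \<in> Obj C" and s: "s \<in> S x x'" and "F \<in> Hom D x y"
  shows "\<exists>y'\<in>Obj D. \<exists>t\<in>S y y'. \<exists>G\<in>Hom D x' y'. Comp D x x' y' G s = Comp D x y y' t F"
proof -
  obtain f where f: "f \<in> Hom C x y" "F = cls x y f" using \<open>F \<in> Hom D x y\<close> by auto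
  from S_cases[OF obj(1,2) s] consider
    \<sigma> where "\<sigma> \<in> W x x'" "s = cls x x' \<sigma>" | "Ident C x \<in> L x x" by blast
  then show ?thesis
  proof cases
    case 1
    obtain y' \<tau> f' where y': "y' \<in> Obj C" "\<tau> \<in> W y y'" "f' \<in> Hom C x' y'"
        "Comp C x x' y' f' \<sigma> = Comp C x y y' \<tau> f"
      using oreE[OF obj 1(1) f(1)] .
    have "Comp D x x' y' (cls x' y' f') s = Comp D x y y' (cls y y' \<tau>) F"
      using 1 y' f obj W_sub by (simp add: quo.quotient_comp)
    then show ?thesis using y' obj residue_in_S[of y y' \<tau>] by auto
  next
    case 2
    obtain \<sigma> where \<sigma>: "\<sigma> \<in> Hom C x x'" "s = cls x x' \<sigma>" using S_sub obj s by blast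
    \<comment> \<open>A null source makes \<open>F\<close> zero, so the zero morphism and the
      identity of \<open>y\<close> close the square whatever \<open>s\<close> is.\<close>
    have "cls x y f = cls x y 0"
      using null_object_source[OF obj(1,3) 2 f(1)] obj by (simp add: quo.residue_class_eq_0_iff)
    then have "Comp D x x' y (cls x' y 0) s = Comp D x y y (cls y y (Ident C y)) F"
      using \<sigma> f obj by (simp add: quo.quotient_comp zero_in ident_in comp_zero_left comp_ident_left)
    moreover have "cls x' y 0 \<in> Hom D x' y" using obj by (simp add: zero_in)
    moreover have "cls y y (Ident C y) \<in> S y y" using obj by (simp add: residue_in_S W_ident)
    ultimately show ?thesis using obj unfolding quo.quotient_simps(1) by blast
  qed
qed

text \<open>Stronger than condition (3): because \<open>L\<close> is saturated, (f - g)\<sigma> in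
  \<open>L\<close> already puts f - g in \<open>L\<close>. An identity therefore serves as the
  morphism required by (3), and dually by (5).\<close>

lemma fraction_cancel:
  assumes obj: "w \<in> Obj C" "x \<in> Obj C" "y \<in> Obj C" and s: "s \<in> S w x"
    and "F \<in> Hom D x y" "G \<in> Hom D x y" and eq: "Comp D w x y F s = Comp D w x y G s"
  shows "F = G"
proof -
  obtain f where f: "f \<in> Hom C x y" "F = cls x y f" using \<open>F \<in> Hom D x y\<close> by auto
  obtain g where g: "g \<in> Hom C x y" "G = cls x y g" using \<open>G \<in> Hom D x y\<close> by auto
  have fg: "f - g \<in> Hom C x y" using obj f g by (simp add: diff_in)
  from S_cases[OF obj(1,2) s] have "f - g \<in> L x y"
  proof (elim disjE conjE imageE)
    fix \<sigma> assume \<sigma>: "s = cls w x \<sigma>" "\<sigma> \<in> W w x"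
    then have "Comp C w x y (f - g) \<sigma> \<in> L w y"
      using eq f g obj W_sub[of w x \<sigma>]
      by (simp add: quo.quotient_comp quo.residue_class_eq_iff comp_diff_left)
    then show ?thesis using saturation_cancel_right obj L_eq \<sigma> fg by blast
  qed (use null_object_source fg obj in auto)
  then show ?thesis using obj f g by (simp add: quo.residue_class_eq_iff)
qed

lemma fraction_class_opposite:
  "fraction_class (opposite C) (\<lambda>x y. I y x) (\<lambda>x y. W y x) (\<lambda>x y. L y x) (\<lambda>x y. S y x)"
proof -
  interpret op: ore_class "opposite C" "\<lambda>x y. I y x" "\<lambda>x y. W y x" by (rule ore_class_opposite)
  have res: "residue_class (\<lambda>x y. L y x) = (\<lambda>x y. residue_class L y x)"
    by (simp add: residue_class_def fun_eq_iff)
  show ?thesis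
  proof
    show "L y x = op.saturation x y" if "x \<in> Obj (opposite C)" "y \<in> Obj (opposite C)" for x y
      using that L_eq saturation_opposite by simp
    show "Comp (quotient_category (opposite C) (\<lambda>x y. L y x)) x y z t s \<in> S z x"
      if "x \<in> Obj (opposite C)" "y \<in> Obj (opposite C)" "z \<in> Obj (opposite C)" "s \<in> S y x" "t \<in> S z y"
      for x y z s t
      using that S_comp[of z y x t s] by (simp add: quo.quotient_opposite)
    show "s \<in> residue_class (\<lambda>x y. L y x) x y ` W y x \<or>
        Ident (opposite C) x \<in> L x x \<and> Ident (opposite C) y \<in> L y y"
      if "x \<in> Obj (opposite C)" "y \<in> Obj (opposite C)" "s \<in> S y x" for x y s
      using that S_cases[of y x s] by (auto simp: res)
  qed (use S_sub residue_in_S in \<open>auto simp: res\<close>)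
qed

theorem fraction_class_calculus_of_fractions: "admits_calculus_of_fractions D S"
proof -
  interpret op: fraction_class "opposite C" "\<lambda>x y. I y x" "\<lambda>x y. W y x" "\<lambda>x y. L y x" "\<lambda>x y. S y x"
    by (rule fraction_class_opposite)
  have opD: "op.D = opposite D" by (rule quo.quotient_opposite)
  have ident: "Ident D x \<in> S x x" if "x \<in> Obj D" for x
    using that residue_in_S W_ident by simp
  show ?thesis
    unfolding admits_calculus_of_fractions_def
  proof (intro conjI ballI impI)
    fix x x' y \<sigma> f
    assume "x \<in> Obj D" "x' \<in> Obj D" "y \<in> Obj D" "\<sigma> \<in> S x' x" "f \<in> Hom D y x"
    then show "\<exists>y'\<in>Obj D. \<exists>\<sigma>'\<in>S y' y. \<exists>f'\<in>Hom D y' x'. Comp D y' x' x \<sigma> f' = Comp D y' y x f \<sigma>'"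
      using op.fraction_ore[of x x' y \<sigma> f] unfolding opD opposite_simps by simp
  next
    fix w x y \<sigma> f g
    assume "w \<in> Obj D" "x \<in> Obj D" "y \<in> Obj D" "\<sigma> \<in> S x w" "f \<in> Hom D y x" "g \<in> Hom D y x"
      "Comp D y x w \<sigma> f = Comp D y x w \<sigma> g"
    then have "f = g"
      using op.fraction_cancel[of w x y \<sigma> f g] unfolding opD opposite_simps by simp
    then show "\<exists>z\<in>Obj D. \<exists>\<sigma>'\<in>S z y. Comp D z y x f \<sigma>' = Comp D z y x g \<sigma>'"
      using \<open>y \<in> Obj D\<close> ident by blast
  next
    fix w x y \<sigma> f g
    assume "w \<in> Obj D" "x \<in> Obj D" "y \<in> Obj D" "\<sigma> \<in> S w x" "f \<in> Hom D x y" "g \<in> Hom D x y"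
      "Comp D w x y f \<sigma> = Comp D w x y g \<sigma>"
    then have "f = g"
      using fraction_cancel[of w x y \<sigma> f g] by simp
    then show "\<exists>z\<in>Obj D. \<exists>\<sigma>'\<in>S y z. Comp D x y z \<sigma>' f = Comp D x y z \<sigma>' g"
      using \<open>y \<in> Obj D\<close> ident by blast
  next
    show "is_category D" by (rule quo.quotient_is_category)
  qed (use S_sub S_comp ident fraction_ore in \<open>auto simp del: quo.quotient_simps(3)\<close>)
qed

end

section \<open>Paths and their classes\<close>

lemma path_concat_0 [simp]: "(\<gamma> \<bullet>\<^sub>p \<delta>) 0 = \<gamma> 0"
  by (simp add: path_concat_def)

lemma path_concat_1 [simp]: "(\<gamma> \<bullet>\<^sub>p \<delta>) 1 = \<delta> 1"
  by (simp add: path_concat_def)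

lemma const_path_0 [simp]: "const_path x 0 = x"
  and const_path_1 [simp]: "const_path x 1 = x"
  by (simp_all add: const_path_def)

lemma image_path_concat:
  assumes "composable \<gamma> \<delta>"
  shows "im (\<gamma> \<bullet>\<^sub>p \<delta>) = im \<gamma> \<union> im \<delta>"
proof (intro equalityI subsetI)
  fix u assume "u \<in> im \<gamma> \<union> im \<delta>"
  then show "u \<in> im (\<gamma> \<bullet>\<^sub>p \<delta>)"
  proof
    assume "u \<in> im \<gamma>"
    then obtain t where "t \<in> {0..1}" "u = \<gamma> t" by auto
    then show ?thesis
      by (intro image_eqI[of _ _ "t / 2"]) (auto simp: path_concat_def)
  next
    assume "u \<in> im \<delta>"
    then obtain t where "t \<in> {0..1}" "u = \<delta> t" by auto
    then show ?thesis using assms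
      \<comment> \<open>For \<open>t = 0\<close> the parameter is 1/2, which the concatenation reads
        on its first branch; composability supplies the value there.\<close>
      by (intro image_eqI[of _ _ "(t + 1) / 2"]) (auto simp: path_concat_def composable_def add_divide_distrib)
  qed
qed (auto simp: path_concat_def)

text \<open>Intervals of the real line are its connected subsets, so continuity yields the interval
  condition.\<close>

lemma continuous_reparametrization:
  assumes "continuous_on {0..1} \<phi>" "mono_on {0..1} \<phi>" "\<phi> 0 = 0" "\<phi> 1 = 1"
  shows "reparametrization \<phi>"
  unfolding reparametrization_def
proof (intro conjI allI impI)
  show "\<phi> \<in> {0..1} \<rightarrow> {0..1}"
  proof
    fix t :: real assume "t \<in> {0..1}"
    then show "\<phi> t \<in> {0..1}"
      using mono_onD[OF assms(2), of 0 t] mono_onD[OF assms(2), of t 1] assms by auto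
  qed
  fix J :: "real set" assume "J \<subseteq> {0..1}" "is_interval J"
  then show "is_interval (\<phi> ` J)"
    using assms(1) connected_continuous_image continuous_on_subset
    by (metis is_interval_connected_1)
qed (rule assms)

section \<open>Concatenation up to equivalence\<close>

locale path_triple =
  fixes T :: "'a triple"
  assumes triple: "is_triple T"
begin

lemma paths_sub: "\<gamma> \<in> paths T \<Longrightarrow> \<gamma> \<in> {0..1} \<rightarrow>\<^sub>E points T"
  using triple by (auto simp: is_triple_def)

lemma path_at: "\<lbrakk>\<gamma> \<in> paths T; t \<in> {0..1}\<rbrakk> \<Longrightarrow> \<gamma> t \<in> points T"
  using paths_sub by blast

lemma equiv_paths: "equiv (paths T) (path_rel T)"
  using triple by (simp add: is_triple_def)

lemma path_equiv_refl: "\<gamma> \<in> paths T \<Longrightarrow> path_equiv T \<gamma> \<gamma>"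
  and path_equiv_sym: "path_equiv T \<gamma> \<delta> \<Longrightarrow> path_equiv T \<delta> \<gamma>"
  and path_equiv_trans [trans]: "\<lbrakk>path_equiv T \<gamma> \<delta>; path_equiv T \<delta> \<epsilon>\<rbrakk> \<Longrightarrow> path_equiv T \<gamma> \<epsilon>"
  and path_equiv_in: "path_equiv T \<gamma> \<delta> \<Longrightarrow> \<gamma> \<in> paths T \<and> \<delta> \<in> paths T"
  using equiv_paths unfolding path_equiv_def
  by (auto elim!: equivE dest: refl_onD symD transD)

lemma path_equiv_ends: "path_equiv T \<gamma> \<delta> \<Longrightarrow> \<gamma> 0 = \<delta> 0 \<and> \<gamma> 1 = \<delta> 1"
  using triple by (simp add: is_triple_def)

lemma concat_in: "\<lbrakk>\<gamma> \<in> paths T; \<delta> \<in> paths T; composable \<gamma> \<delta>\<rbrakk> \<Longrightarrow> \<gamma> \<bullet>\<^sub>p \<delta> \<in> paths T"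
  using triple by (simp add: is_triple_def)

lemma const_path_in: "x \<in> points T \<Longrightarrow> const_path x \<in> paths T"
  using triple by (simp add: is_triple_def)

lemma path_equiv_reparametrization:
  assumes "\<gamma> \<in> paths T" "continuous_on {0..1} \<phi>" "mono_on {0..1} \<phi>" "\<phi> 0 = 0" "\<phi> 1 = 1"
    and "\<delta> = compose {0..1} \<gamma> \<phi>"
  shows "path_equiv T \<gamma> \<delta>"
proof -
  have "\<forall>\<gamma>\<in>paths T. \<forall>\<phi>. reparametrization \<phi> \<and> \<phi> 0 = 0 \<and> \<phi> 1 = 1 \<longrightarrow>
      path_equiv T \<gamma> (compose {0..1} \<gamma> \<phi>)"
    using triple by (simp add: is_triple_def)
  then show ?thesis using assms continuous_reparametrization by blast
qed

lemma path_equiv_concat_assoc: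
  assumes "\<alpha> \<in> paths T" "\<beta> \<in> paths T" "\<gamma> \<in> paths T" "composable \<alpha> \<beta>" "composable \<beta> \<gamma>"
  shows "path_equiv T ((\<alpha> \<bullet>\<^sub>p \<beta>) \<bullet>\<^sub>p \<gamma>) (\<alpha> \<bullet>\<^sub>p (\<beta> \<bullet>\<^sub>p \<gamma>))"
proof (rule path_equiv_reparametrization)
  \<comment> \<open>\<phi> carries the breakpoints 1/2, 3/4 of the right-nested concatenation to
    1/4, 1/2. Its slopes 1/2, 1, 2 increase, so it is the maximum of its affine pieces, and
    continuity and monotonicity are inherited from them.\<close>
  define \<phi> where "\<phi> t = max (t / 2) (max (t - 1/4) (2 * t - 1))" for t :: real
  show "(\<alpha> \<bullet>\<^sub>p \<beta>) \<bullet>\<^sub>p \<gamma> \<in> paths T"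
    using assms by (simp add: concat_in composable_def)
  show "continuous_on {0..1} \<phi>" unfolding \<phi>_def by (intro continuous_intros) auto
  show "mono_on {0..1} \<phi>" unfolding mono_on_def \<phi>_def by (intro allI impI max.mono) auto
  show "\<phi> 0 = 0" "\<phi> 1 = 1" by (auto simp: \<phi>_def)
  have "(\<alpha> \<bullet>\<^sub>p \<beta> \<bullet>\<^sub>p \<gamma>) t = compose {0..1} ((\<alpha> \<bullet>\<^sub>p \<beta>) \<bullet>\<^sub>p \<gamma>) \<phi> t" for t
  proof (cases "t \<in> {0..1}")
    case True
    then consider "t \<le> 1/2" | "1/2 < t" "t \<le> 3/4" | "3/4 < t" by linarith
    then show ?thesis
    proof cases
      case 1
      then have \<phi>: "\<phi> t = t / 2" by (simp add: \<phi>_def)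
      show ?thesis using True 1 by (simp add: compose_def path_concat_def \<phi>)
    next
      case 2
      then have \<phi>: "\<phi> t = t - 1/4" by (simp add: \<phi>_def)
      show ?thesis using True 2 by (simp add: compose_def path_concat_def algebra_simps \<phi>)
    next
      case 3
      then have \<phi>: "\<phi> t = 2 * t - 1" by (simp add: \<phi>_def)
      show ?thesis using True 3 by (simp add: compose_def path_concat_def algebra_simps \<phi>)
    qed
  qed (auto simp: compose_def path_concat_def)
  then show "\<alpha> \<bullet>\<^sub>p \<beta> \<bullet>\<^sub>p \<gamma> = compose {0..1} ((\<alpha> \<bullet>\<^sub>p \<beta>) \<bullet>\<^sub>p \<gamma>) \<phi>" ..
qed

lemma path_equiv_const_concat:
  assumes "\<gamma> \<in> paths T"
  shows "path_equiv T \<gamma> (const_path (\<gamma> 0) \<bullet>\<^sub>p \<gamma>)"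
proof (rule path_equiv_reparametrization)
  \<comment> \<open>\<phi> waits at 0 during the first half, reproducing the constant piece.\<close>
  define \<phi> where "\<phi> t = max 0 (2 * t - 1)" for t :: real
  show "continuous_on {0..1} \<phi>" unfolding \<phi>_def by (intro continuous_intros)
  show "mono_on {0..1} \<phi>" by (auto simp: mono_on_def \<phi>_def)
  show "\<phi> 0 = 0" "\<phi> 1 = 1" by (auto simp: \<phi>_def)
  have "\<phi> t = (if t \<le> 1/2 then 0 else 2 * t - 1)" for t by (simp add: \<phi>_def max_def)
  then show "const_path (\<gamma> 0) \<bullet>\<^sub>p \<gamma> = compose {0..1} \<gamma> \<phi>"
    by (auto simp: compose_def path_concat_def const_path_def fun_eq_iff)
qed (rule assms)

lemma path_equiv_concat_const:
  assumes "\<gamma> \<in> paths T"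
  shows "path_equiv T \<gamma> (\<gamma> \<bullet>\<^sub>p const_path (\<gamma> 1))"
proof (rule path_equiv_reparametrization)
  define \<phi> where "\<phi> t = min (2 * t) 1" for t :: real
  show "continuous_on {0..1} \<phi>" unfolding \<phi>_def by (intro continuous_intros)
  show "mono_on {0..1} \<phi>" by (auto simp: mono_on_def \<phi>_def)
  show "\<phi> 0 = 0" "\<phi> 1 = 1" by (auto simp: \<phi>_def)
  have "\<phi> t = (if t \<le> 1/2 then 2 * t else 1)" for t by (simp add: \<phi>_def min_def)
  then show "\<gamma> \<bullet>\<^sub>p const_path (\<gamma> 1) = compose {0..1} \<gamma> \<phi>"
    by (auto simp: compose_def path_concat_def const_path_def fun_eq_iff)
qed (rule assms)

lemma path_equiv_sandwich:
  assumes "path_equiv T \<gamma> \<gamma>'" "\<rho> \<in> paths T" "\<rho>' \<in> paths T" "composable \<rho> \<gamma>" "composable \<gamma> \<rho>'"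
  shows "path_equiv T (\<rho> \<bullet>\<^sub>p \<gamma> \<bullet>\<^sub>p \<rho>') (\<rho> \<bullet>\<^sub>p \<gamma>' \<bullet>\<^sub>p \<rho>')"
proof -
  have \<gamma>: "\<gamma> \<in> paths T" "\<gamma>' \<in> paths T" using assms(1) path_equiv_in by auto
  have c: "composable \<rho> \<gamma>'" "composable \<gamma>' \<rho>'"
    using assms path_equiv_ends[OF assms(1)] by (auto simp: composable_def)
  have "\<rho> \<bullet>\<^sub>p \<gamma> \<bullet>\<^sub>p \<rho>' \<in> paths T" "\<rho> \<bullet>\<^sub>p \<gamma>' \<bullet>\<^sub>p \<rho>' \<in> paths T"
    using assms \<gamma> c by (simp_all add: concat_in composable_def)
  moreover have "\<forall>\<gamma>\<in>paths T. \<forall>\<gamma>'\<in>paths T. \<forall>\<rho>\<in>paths T. \<forall>\<rho>'\<in>paths T.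
        composable \<rho> \<gamma> \<and> composable \<gamma> \<rho>' \<and> composable \<rho> \<gamma>' \<and> composable \<gamma>' \<rho>' \<and>
        \<rho> \<bullet>\<^sub>p \<gamma> \<bullet>\<^sub>p \<rho>' \<in> paths T \<and> \<rho> \<bullet>\<^sub>p \<gamma>' \<bullet>\<^sub>p \<rho>' \<in> paths T \<longrightarrow>
        (path_equiv T \<gamma> \<gamma>' \<longleftrightarrow> path_equiv T (\<rho> \<bullet>\<^sub>p \<gamma> \<bullet>\<^sub>p \<rho>') (\<rho> \<bullet>\<^sub>p \<gamma>' \<bullet>\<^sub>p \<rho>'))"
    using triple unfolding is_triple_def by (elim conjE)
  ultimately show ?thesis using assms \<gamma> c by blast
qed

text \<open>Axiom (f) speaks of factors on both sides; the missing left factor is a constant path,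
  inserted and removed by reparametrization.\<close>

lemma path_equiv_concat_right:
  assumes "path_equiv T \<gamma> \<gamma>'" "\<rho> \<in> paths T" "composable \<gamma> \<rho>"
  shows "path_equiv T (\<gamma> \<bullet>\<^sub>p \<rho>) (\<gamma>' \<bullet>\<^sub>p \<rho>)"
proof -
  have \<gamma>: "\<gamma> \<in> paths T" "\<gamma>' \<in> paths T" "\<gamma> 0 = \<gamma>' 0" "\<gamma> 1 = \<gamma>' 1"
    using path_equiv_in[OF assms(1)] path_equiv_ends[OF assms(1)] by auto
  then have c: "composable \<gamma>' \<rho>" using assms by (simp add: composable_def)
  have "path_equiv T (\<gamma> \<bullet>\<^sub>p \<rho>) (const_path (\<gamma> 0) \<bullet>\<^sub>p \<gamma> \<bullet>\<^sub>p \<rho>)"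
    using path_equiv_const_concat[OF concat_in[OF \<gamma>(1) assms(2,3)]] by simp
  also have "path_equiv T \<dots> (const_path (\<gamma> 0) \<bullet>\<^sub>p \<gamma>' \<bullet>\<^sub>p \<rho>)"
    using assms \<gamma> path_at[of \<gamma> 0] by (intro path_equiv_sandwich const_path_in) (auto simp: composable_def)
  also have "path_equiv T \<dots> (\<gamma>' \<bullet>\<^sub>p \<rho>)"
    using path_equiv_const_concat[OF concat_in[OF \<gamma>(2) assms(2) c]] \<gamma> by (simp add: path_equiv_sym)
  finally show ?thesis .
qed

text \<open>Here the constant path must be placed innermost to match the right-nested form of (f),
  which costs one use of associativity.\<close>

lemma path_equiv_concat_left:
  assumes "path_equiv T \<gamma> \<gamma>'" "\<rho> \<in> paths T" "composable \<rho> \<gamma>"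
  shows "path_equiv T (\<rho> \<bullet>\<^sub>p \<gamma>) (\<rho> \<bullet>\<^sub>p \<gamma>')"
proof -
  have \<gamma>: "\<gamma> \<in> paths T" "\<gamma>' \<in> paths T" "\<gamma> 0 = \<gamma>' 0" "\<gamma> 1 = \<gamma>' 1"
    using path_equiv_in[OF assms(1)] path_equiv_ends[OF assms(1)] by auto
  have const: "const_path (\<gamma> 1) \<in> paths T" using \<gamma> path_at[of \<gamma> 1] const_path_in by simp
  have c: "path_equiv T (\<rho> \<bullet>\<^sub>p \<delta>) (\<rho> \<bullet>\<^sub>p \<delta> \<bullet>\<^sub>p const_path (\<gamma> 1))"
    if "\<delta> \<in> paths T" "\<delta> 0 = \<gamma> 0" "\<delta> 1 = \<gamma> 1" for \<delta>
  proof -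
    have "composable \<rho> \<delta>" "composable \<delta> (const_path (\<gamma> 1))"
      using that assms by (simp_all add: composable_def)
    then show ?thesis
      using path_equiv_trans[OF path_equiv_concat_const path_equiv_concat_assoc, of \<rho> \<delta>]
        that assms const concat_in[of \<rho> \<delta>] by (simp add: that)
  qed
  have "path_equiv T (\<rho> \<bullet>\<^sub>p \<gamma>) (\<rho> \<bullet>\<^sub>p \<gamma> \<bullet>\<^sub>p const_path (\<gamma> 1))"
    using c \<gamma> by simp
  also have "path_equiv T \<dots> (\<rho> \<bullet>\<^sub>p \<gamma>' \<bullet>\<^sub>p const_path (\<gamma> 1))"
    using assms const by (intro path_equiv_sandwich) (auto simp: composable_def)
  also have "path_equiv T \<dots> (\<rho> \<bullet>\<^sub>p \<gamma>')"
    using c[of \<gamma>'] \<gamma> by (simp add: path_equiv_sym)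
  finally show ?thesis .
qed

lemma path_equiv_concat:
  assumes "path_equiv T \<gamma> \<gamma>'" "path_equiv T \<delta> \<delta>'" "composable \<gamma> \<delta>"
  shows "path_equiv T (\<gamma> \<bullet>\<^sub>p \<delta>) (\<gamma>' \<bullet>\<^sub>p \<delta>')"
proof (rule path_equiv_trans)
  show "path_equiv T (\<gamma> \<bullet>\<^sub>p \<delta>) (\<gamma>' \<bullet>\<^sub>p \<delta>)"
    using assms path_equiv_in by (intro path_equiv_concat_right) auto
  show "path_equiv T (\<gamma>' \<bullet>\<^sub>p \<delta>) (\<gamma>' \<bullet>\<^sub>p \<delta>')"
    using assms path_equiv_in path_equiv_ends[OF assms(1)]
    by (intro path_equiv_concat_left) (auto simp: composable_def)
qed

lemma path_class_eq_iff:
  "\<lbrakk>\<gamma> \<in> paths T; \<delta> \<in> paths T\<rbrakk> \<Longrightarrow> path_class T \<gamma> = path_class T \<delta> \<longleftrightarrow> path_equiv T \<gamma> \<delta>"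
  unfolding path_class_def path_equiv_def using eq_equiv_class_iff[OF equiv_paths] by blast

lemma path_class_eqI: "path_equiv T \<gamma> \<delta> \<Longrightarrow> path_class T \<gamma> = path_class T \<delta>"
  using path_class_eq_iff path_equiv_in by blast

text \<open>Concatenation respects equivalence, so all sets in the union defining
  \<open>class_concat\<close> coincide.\<close>

lemma class_concat_path_class:
  assumes "\<gamma> \<in> paths T" "\<delta> \<in> paths T" "composable \<gamma> \<delta>"
  shows "class_concat T (path_class T \<gamma>) (path_class T \<delta>) = path_class T (\<gamma> \<bullet>\<^sub>p \<delta>)"
proof -
  have "path_class T (\<gamma>' \<bullet>\<^sub>p \<delta>') = path_class T (\<gamma> \<bullet>\<^sub>p \<delta>)"
    if "\<gamma>' \<in> path_class T \<gamma>" "\<delta>' \<in> path_class T \<delta>" for \<gamma>' \<delta>'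
    using that assms path_class_eqI[OF path_equiv_concat, of \<gamma> \<gamma>' \<delta> \<delta>']
    by (simp add: path_class_def path_equiv_def)
  moreover have "\<gamma> \<in> path_class T \<gamma>" "\<delta> \<in> path_class T \<delta>"
    using assms path_equiv_refl by (simp_all add: path_class_def path_equiv_def)
  ultimately show ?thesis unfolding class_concat_def by blast
qed

end

section \<open>The linear path category\<close>

text \<open>The support of a sum can be smaller than the union of the supports. Summing over fixed
  larger index sets, where the extra terms have coefficient 0, makes bilinearity a termwise
  computation.\<close>

lemma lin_path_comp_superset:
  assumes "finite A" "finite B" "Poly_Mapping.keys f \<subseteq> A" "Poly_Mapping.keys g \<subseteq> B"
  shows "lin_path_comp T g f = (\<Sum>c\<in>A. \<Sum>d\<in>B.
    Poly_Mapping.single (class_concat T c d) (Poly_Mapping.lookup g d * Poly_Mapping.lookup f c))"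
proof -
  have "lin_path_comp T g f = (\<Sum>c\<in>Poly_Mapping.keys f. \<Sum>d\<in>B.
      Poly_Mapping.single (class_concat T c d) (Poly_Mapping.lookup g d * Poly_Mapping.lookup f c))"
    unfolding lin_path_comp_def using assms
    by (intro sum.cong sum.mono_neutral_left) (auto simp: in_keys_iff)
  also have "\<dots> = (\<Sum>c\<in>A. \<Sum>d\<in>B.
      Poly_Mapping.single (class_concat T c d) (Poly_Mapping.lookup g d * Poly_Mapping.lookup f c))"
    using assms by (intro sum.mono_neutral_left) (auto simp: in_keys_iff)
  finally show ?thesis .
qed

lemma lin_path_comp_add_left: "lin_path_comp T (g + g') f = lin_path_comp T g f + lin_path_comp T g' f"
proof -
  let ?A = "Poly_Mapping.keys f" and ?B = "Poly_Mapping.keys g \<union> Poly_Mapping.keys g'"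
  show ?thesis
    using lin_path_comp_superset[of ?A ?B f "g + g'"] lin_path_comp_superset[of ?A ?B f g]
      lin_path_comp_superset[of ?A ?B f g'] keys_add[of g g']
    by (simp add: lookup_add distrib_right single_add sum.distrib)
qed

lemma lin_path_comp_add_right: "lin_path_comp T g (f + f') = lin_path_comp T g f + lin_path_comp T g f'"
proof -
  let ?A = "Poly_Mapping.keys f \<union> Poly_Mapping.keys f'" and ?B = "Poly_Mapping.keys g"
  show ?thesis
    using lin_path_comp_superset[of ?A ?B "f + f'" g] lin_path_comp_superset[of ?A ?B f g]
      lin_path_comp_superset[of ?A ?B f' g] keys_add[of f f']
    by (simp add: lookup_add distrib_left single_add sum.distrib)
qed

lemma lin_path_comp_zero [simp]: "lin_path_comp T 0 f = 0" "lin_path_comp T g 0 = 0"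
  by (simp_all add: lin_path_comp_def)

lemma lin_path_comp_sum_left: "lin_path_comp T (\<Sum>i\<in>A. g i) f = (\<Sum>i\<in>A. lin_path_comp T (g i) f)"
  by (induction A rule: infinite_finite_induct) (simp_all add: lin_path_comp_add_left)

lemma lin_path_comp_sum_right: "lin_path_comp T g (\<Sum>i\<in>A. f i) = (\<Sum>i\<in>A. lin_path_comp T g (f i))"
  by (induction A rule: infinite_finite_induct) (simp_all add: lin_path_comp_add_right)

lemma lin_path_comp_single:
  "lin_path_comp T (Poly_Mapping.single d b) (Poly_Mapping.single c a) =
    Poly_Mapping.single (class_concat T c d) (b * a)"
  by (subst lin_path_comp_superset[of "{c}" "{d}"]) auto

lemma path_category_simps [simp]:
  "Obj (path_category T) = insert None (Some ` points T)"
  "Hom (path_category T) x y = {f. Poly_Mapping.keys f \<subseteq> path_class T ` paths_between T x y}"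
  "Comp (path_category T) x y z g f = lin_path_comp T g f"
  "Ident (path_category T) None = 0"
  "Ident (path_category T) (Some p) = path_mor T (const_path p)"
  by (simp_all add: path_category_def)

lemma scaled_path_in_Hom: "\<gamma> \<in> paths_between T x y \<Longrightarrow> scaled_path T a \<gamma> \<in> Hom (path_category T) x y"
  by (auto simp: scaled_path_def)

lemma Hom_path_category_add:
  "\<lbrakk>f \<in> Hom (path_category T) x y; g \<in> Hom (path_category T) x y\<rbrakk> \<Longrightarrow> f + g \<in> Hom (path_category T) x y"
  using keys_add[of f g] by auto

text \<open>One representative is chosen for each class in the support. Indexing by natural numbers
  gives the shape used in \<open>screen_equiv_mors\<close>.\<close>

lemma Hom_path_category_enumerate:
  assumes "f \<in> Hom (path_category T) x y"
  obtains n :: nat and cs \<gamma> where "\<And>i. i < n \<Longrightarrow> \<gamma> i \<in> paths_between T x y"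
    "f = (\<Sum>i<n. scaled_path T (cs i) (\<gamma> i))"
proof -
  obtain h :: "nat \<Rightarrow> _" where h: "bij_betw h {..<card (Poly_Mapping.keys f)} (Poly_Mapping.keys f)"
    using ex_bij_betw_nat_finite[of "Poly_Mapping.keys f"] by (auto simp: atLeast0LessThan)
  let ?n = "card (Poly_Mapping.keys f)"
  have "\<exists>\<delta>. \<delta> \<in> paths_between T x y \<and> h i = path_class T \<delta>" if "i < ?n" for i
    using assms bij_betwE[OF h] that by auto
  then obtain \<gamma> where \<gamma>: "\<And>i. i < ?n \<Longrightarrow> \<gamma> i \<in> paths_between T x y \<and> h i = path_class T (\<gamma> i)"
    by metis
  have "f = (\<Sum>c\<in>Poly_Mapping.keys f. Poly_Mapping.single c (Poly_Mapping.lookup f c))"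
    by (rule poly_mapping_eqI) (auto simp: lookup_sum lookup_single when_def in_keys_iff)
  also have "\<dots> = (\<Sum>i<?n. Poly_Mapping.single (h i) (Poly_Mapping.lookup f (h i)))"
    by (rule sum.reindex_bij_betw[OF h, symmetric])
  also have "\<dots> = (\<Sum>i<?n. scaled_path T (Poly_Mapping.lookup f (h i)) (\<gamma> i))"
    using \<gamma> by (auto simp: scaled_path_def)
  finally show ?thesis using that[of ?n \<gamma> "\<lambda>i. Poly_Mapping.lookup f (h i)"] \<gamma> by blast
qed

lemma Hom_path_category_induct [consumes 1, case_names zero scaled_path add]:
  assumes "f \<in> Hom (path_category T) x y"
    and "P 0" "\<And>\<gamma> a. \<gamma> \<in> paths_between T x y \<Longrightarrow> P (scaled_path T a \<gamma>)"
    and add: "\<And>f g. \<lbrakk>f \<in> Hom (path_category T) x y; g \<in> Hom (path_category T) x y; P f; P g\<rbrakk> \<Longrightarrow> P (f + g)"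
  shows "P f"
proof -
  obtain n :: nat and cs \<gamma> where \<gamma>: "\<And>i. i < n \<Longrightarrow> \<gamma> i \<in> paths_between T x y"
    "f = (\<Sum>i<n. scaled_path T (cs i) (\<gamma> i))"
    using Hom_path_category_enumerate[OF assms(1)] by blast
  let ?S = "\<lambda>k. \<Sum>i<k. scaled_path T (cs i) (\<gamma> i)"
  \<comment> \<open>Partial sums are followed together with their membership in the Hom-set, because
    the case \<open>add\<close> may assume it.\<close>
  have "k \<le> n \<Longrightarrow> ?S k \<in> Hom (path_category T) x y \<and> P (?S k)" for k
  proof (induction k)
    case (Suc k)
    have "scaled_path T (cs k) (\<gamma> k) \<in> Hom (path_category T) x y"
      using \<gamma> Suc.prems by (intro scaled_path_in_Hom) auto
    then show ?case
      using Suc.IH Suc.prems assms(3)[OF \<gamma>(1)[of k]]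
      by (simp only: sum.lessThan_Suc Suc_le_eq less_imp_le Hom_path_category_add add)
  qed (simp add: assms)
  then show ?thesis using \<gamma>(2) by simp
qed

lemma Hom_path_category_None [simp]:
  "f \<in> Hom (path_category T) None y \<longleftrightarrow> f = 0" "f \<in> Hom (path_category T) x None \<longleftrightarrow> f = 0"
  by (auto simp: paths_between_def)

context path_triple begin

lemma lin_path_comp_scaled:
  assumes "\<gamma> \<in> paths_between T x y" "\<delta> \<in> paths_between T y z"
  shows "lin_path_comp T (scaled_path T b \<delta>) (scaled_path T a \<gamma>) = scaled_path T (b * a) (\<gamma> \<bullet>\<^sub>p \<delta>)"
    and "\<gamma> \<bullet>\<^sub>p \<delta> \<in> paths_between T x z"
  using assms unfolding scaled_path_def lin_path_comp_single
  by (auto simp: class_concat_path_class paths_between_def composable_def concat_in)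

lemma scaled_path_cong: "path_equiv T \<gamma> \<delta> \<Longrightarrow> scaled_path T a \<gamma> = scaled_path T a \<delta>"
  by (simp add: scaled_path_def path_class_eqI)

text \<open>Composition is biadditive, so the axioms reduce, one argument at a time, to scalar
  multiples of single paths and there to the rules for concatenation. At the zero object only the
  zero morphism occurs.\<close>

lemma preadditive_path_category:
  "preadditive_category (path_category T :: ('a option, ('a, 'k::{comm_ring,comm_monoid_mult}) lin_path) category)"
    (is "preadditive_category ?C")
proof
  have comp_in: "lin_path_comp T g f \<in> Hom ?C x z" if "f \<in> Hom ?C x y" "g \<in> Hom ?C y z" for x y z f g
    using that(1)
  proof (induction rule: Hom_path_category_induct)
    case (scaled_path \<gamma> a)
    note \<gamma> = this
    show ?case using that(2)
    proof (induction rule: Hom_path_category_induct)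
      case (scaled_path \<delta> b)
      show ?case
        unfolding lin_path_comp_scaled(1)[OF \<gamma> scaled_path]
        by (rule scaled_path_in_Hom[OF lin_path_comp_scaled(2)[OF \<gamma> scaled_path]])
    qed (simp, simp only: lin_path_comp_add_left Hom_path_category_add)
  qed (simp, simp only: lin_path_comp_add_right Hom_path_category_add)
  have comp_assoc: "lin_path_comp T (lin_path_comp T h g) f = lin_path_comp T h (lin_path_comp T g f)"
    if f: "f \<in> Hom ?C w x" and g: "g \<in> Hom ?C x y" and h: "h \<in> Hom ?C y z" for w x y z f g h
    using f
  proof (induction rule: Hom_path_category_induct)
    case (scaled_path \<alpha> a)
    note \<alpha> = this
    show ?case using g
    proof (induction rule: Hom_path_category_induct)
      case (scaled_path \<beta> b)
      note \<beta> = this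
      show ?case using h
      proof (induction rule: Hom_path_category_induct)
        case (scaled_path \<gamma> c)
        have "path_equiv T (\<alpha> \<bullet>\<^sub>p \<beta> \<bullet>\<^sub>p \<gamma>) ((\<alpha> \<bullet>\<^sub>p \<beta>) \<bullet>\<^sub>p \<gamma>)"
          using \<alpha> \<beta> scaled_path
          by (intro path_equiv_sym[OF path_equiv_concat_assoc]) (auto simp: paths_between_def composable_def)
        then show ?case
          by (simp add: mult.assoc scaled_path_cong lin_path_comp_scaled(1)[OF \<alpha> \<beta>]
              lin_path_comp_scaled(1)[OF \<beta> scaled_path]
              lin_path_comp_scaled(1)[OF \<alpha> lin_path_comp_scaled(2)[OF \<beta> scaled_path]]
              lin_path_comp_scaled(1)[OF lin_path_comp_scaled(2)[OF \<alpha> \<beta>] scaled_path])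
      qed (simp_all add: lin_path_comp_add_left)
    qed (simp_all add: lin_path_comp_add_left lin_path_comp_add_right)
  qed (simp_all add: lin_path_comp_add_right)
  have ident: "Ident ?C x \<in> Hom ?C x x" if "x \<in> Obj ?C" for x
    using that
    by (auto simp: path_mor_def scaled_path_def paths_between_def const_path_in split: if_splits)
  have ident_right: "lin_path_comp T f (Ident ?C x) = f" if "x \<in> Obj ?C" "f \<in> Hom ?C x y" for x y f
    using that(2)
  proof (induction rule: Hom_path_category_induct)
    case (scaled_path \<gamma> a)
    then have \<gamma>: "\<gamma> \<in> paths T" "x = Some (\<gamma> 0)" by (auto simp: paths_between_def)
    then have c: "const_path (\<gamma> 0) \<in> paths_between T x x"
      using path_at[of \<gamma> 0] by (simp add: paths_between_def const_path_in)
    show ?case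
      by (simp add: path_mor_def \<gamma>(2) lin_path_comp_scaled(1)[OF c scaled_path]
          scaled_path_cong[OF path_equiv_const_concat[OF \<gamma>(1)], symmetric])
  qed (simp_all add: lin_path_comp_add_left)
  have ident_left: "lin_path_comp T (Ident ?C y) f = f" if "y \<in> Obj ?C" "f \<in> Hom ?C x y" for x y f
    using that(2)
  proof (induction rule: Hom_path_category_induct)
    case (scaled_path \<gamma> a)
    then have \<gamma>: "\<gamma> \<in> paths T" "y = Some (\<gamma> 1)" by (auto simp: paths_between_def)
    then have c: "const_path (\<gamma> 1) \<in> paths_between T y y"
      using path_at[of \<gamma> 1] by (simp add: paths_between_def const_path_in)
    show ?case
      by (simp add: path_mor_def \<gamma>(2) lin_path_comp_scaled(1)[OF scaled_path c]
          scaled_path_cong[OF path_equiv_concat_const[OF \<gamma>(1)], symmetric])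
  qed (simp_all add: lin_path_comp_add_right)
  show "is_category ?C"
    unfolding is_category_def path_category_simps(3)
    by (intro conjI ballI; (rule comp_assoc comp_in ident ident_left ident_right; assumption))
  show "f + g \<in> Hom ?C x y" if "f \<in> Hom ?C x y" "g \<in> Hom ?C x y" for x y f g
    using that by (rule Hom_path_category_add)
qed (simp_all add: lin_path_comp_add_left lin_path_comp_add_right)

end

section \<open>Directedness of pixels\<close>

text \<open>The Church-Rosser argument: confluence turns each backward step of a zigzag into a
  further common successor.\<close>

lemma zigzag_joinable:
  assumes refl: "r x x" and trans: "\<And>a b c. r a b \<Longrightarrow> r b c \<Longrightarrow> r a c"
    and confluent: "\<And>a b c. r a b \<Longrightarrow> r a c \<Longrightarrow> \<exists>d. r b d \<and> r c d"
    and "(\<lambda>a b. r a b \<or> r b a)\<^sup>*\<^sup>* x y"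
  shows "\<exists>d. r x d \<and> r y d"
  using assms(4)
proof (induction rule: rtranclp_induct)
  case (step y z)
  then show ?case using trans confluent by metis
qed (use refl in blast)

text \<open>A bound \<open>d\<close> of the old elements and a common successor \<open>e\<close> of
  the new element and some old \<open>b\<close> both lie above \<open>b\<close>, so confluence at
  \<open>b\<close> joins them.\<close>

lemma finite_directed:
  assumes "finite A" "A \<noteq> {}" and trans: "\<And>a b c. r a b \<Longrightarrow> r b c \<Longrightarrow> r a c"
    and confluent: "\<And>a b c. r a b \<Longrightarrow> r a c \<Longrightarrow> \<exists>d. r b d \<and> r c d"
    and "\<And>a b. a \<in> A \<Longrightarrow> b \<in> A \<Longrightarrow> \<exists>d. r a d \<and> r b d"
  shows "\<exists>d. \<forall>a\<in>A. r a d"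
  using assms(1,2,5)
proof (induction rule: finite_ne_induct)
  case (insert a A)
  then obtain d where d: "\<forall>b\<in>A. r b d" by blast
  obtain b where "b \<in> A" using insert by blast
  then obtain e where "r a e" "r b e" using insert.prems by blast
  then show ?case using d \<open>b \<in> A\<close> trans confluent[of b d e] by (metis insert_iff)
qed blast

lemma path_reverse_ends [simp]: "path_reverse \<gamma> 0 = \<gamma> 1" "path_reverse \<gamma> 1 = \<gamma> 0"
  by (simp_all add: path_reverse_def)

lemma im_const_path [simp]: "im (const_path x) = {x}"
  by (auto simp: const_path_def intro!: image_eqI[of _ _ 0])

text \<open>On a pixel this is a preorder, and the walks of (S2) are its zigzags.\<close>

definition reachable_in :: "'a triple \<Rightarrow> 'a set \<Rightarrow> 'a \<Rightarrow> 'a \<Rightarrow> bool" where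
  "reachable_in T X a b \<longleftrightarrow> (\<exists>\<rho>\<in>paths T. \<rho> 0 = a \<and> \<rho> 1 = b \<and> im \<rho> \<subseteq> X)"

section \<open>The reachability preorder of a pixel\<close>

locale screened_triple = path_triple T for T :: "'a triple" +
  fixes P :: "'a set set"
  assumes screen: "is_screen T P"
begin

lemma pixels: "partition_on (points T) P"
  using screen by (simp add: is_screen_def)

lemma pixel_unique: "\<lbrakk>X \<in> P; Y \<in> P; a \<in> X; a \<in> Y\<rbrakk> \<Longrightarrow> X = Y"
  using pixels by (metis IntI empty_iff disjointD partition_onD2)

lemma pixel_point: "\<lbrakk>X \<in> P; a \<in> X\<rbrakk> \<Longrightarrow> a \<in> points T"
  using pixels by (auto dest: partition_onD1)

lemma point_pixel: "a \<in> points T \<Longrightarrow> \<exists>X\<in>P. a \<in> X"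
  using pixels by (auto dest: partition_onD1)

lemma pixel_paths_equiv_iff:
  "\<lbrakk>X \<in> P; \<gamma> \<in> paths T; \<delta> \<in> paths T; \<gamma> 0 = \<delta> 0; \<gamma> 1 = \<delta> 1; im \<gamma> \<subseteq> X\<rbrakk> \<Longrightarrow>
    path_equiv T \<gamma> \<delta> \<longleftrightarrow> im \<delta> \<subseteq> X"
  using screen by (simp add: is_screen_def)

lemma in_pixel_start: "\<lbrakk>in_pixel P A; X \<in> P; a \<in> A; a \<in> X\<rbrakk> \<Longrightarrow> A \<subseteq> X"
  using pixel_unique by (auto simp: in_pixel_def)

lemma screen_ore:
  assumes "\<rho> \<in> paths T" "\<gamma> \<in> paths T" "\<rho> 0 = \<gamma> 0" "in_pixel P (im \<rho>)"
  obtains \<rho>' \<gamma>' where "\<rho>' \<in> paths T" "\<gamma>' \<in> paths T" "in_pixel P (im \<rho>')" "composable \<gamma> \<rho>'"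
    "composable \<rho> \<gamma>'" "path_equiv T (\<gamma> \<bullet>\<^sub>p \<rho>') (\<rho> \<bullet>\<^sub>p \<gamma>')"
proof -
  have "\<forall>\<rho>\<in>paths T. \<forall>\<gamma>\<in>paths T. \<rho> 0 = \<gamma> 0 \<and> in_pixel P (im \<rho>) \<longrightarrow>
      (\<exists>\<rho>'\<in>paths T. \<exists>\<gamma>'\<in>paths T. in_pixel P (im \<rho>') \<and> composable \<gamma> \<rho>' \<and> composable \<rho> \<gamma>' \<and>
        path_equiv T (\<gamma> \<bullet>\<^sub>p \<rho>') (\<rho> \<bullet>\<^sub>p \<gamma>'))"
    using screen unfolding is_screen_def by (elim conjE)
  then show ?thesis using assms that by blast
qed

lemma screen_ore_dual:
  assumes "\<rho>' \<in> paths T" "\<gamma>' \<in> paths T" "\<rho>' 1 = \<gamma>' 1" "in_pixel P (im \<rho>')"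
  obtains \<rho> \<gamma> where "\<rho> \<in> paths T" "\<gamma> \<in> paths T" "in_pixel P (im \<rho>)" "composable \<gamma> \<rho>'"
    "composable \<rho> \<gamma>'" "path_equiv T (\<gamma> \<bullet>\<^sub>p \<rho>') (\<rho> \<bullet>\<^sub>p \<gamma>')"
proof -
  have "\<forall>\<rho>'\<in>paths T. \<forall>\<gamma>'\<in>paths T. \<rho>' 1 = \<gamma>' 1 \<and> in_pixel P (im \<rho>') \<longrightarrow>
      (\<exists>\<rho>\<in>paths T. \<exists>\<gamma>\<in>paths T. in_pixel P (im \<rho>) \<and> composable \<gamma> \<rho>' \<and> composable \<rho> \<gamma>' \<and>
        path_equiv T (\<gamma> \<bullet>\<^sub>p \<rho>') (\<rho> \<bullet>\<^sub>p \<gamma>'))"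
    using screen unfolding is_screen_def by (elim conjE)
  then show ?thesis using assms that by blast
qed

lemma reachable_in_refl: "\<lbrakk>X \<in> P; a \<in> X\<rbrakk> \<Longrightarrow> reachable_in T X a a"
  using pixel_point unfolding reachable_in_def by (intro bexI[of _ "const_path a"] const_path_in) (simp_all only: const_path_0 const_path_1 im_const_path, auto)

lemma reachable_in_trans:
  assumes "reachable_in T X a b" "reachable_in T X b c"
  shows "reachable_in T X a c"
proof -
  obtain \<rho> \<tau> where "\<rho> \<in> paths T" "\<rho> 0 = a" "\<rho> 1 = b" "im \<rho> \<subseteq> X"
    "\<tau> \<in> paths T" "\<tau> 0 = b" "\<tau> 1 = c" "im \<tau> \<subseteq> X"
    using assms by (auto simp: reachable_in_def)
  then show ?thesis
    unfolding reachable_in_def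
    by (intro bexI[of _ "\<rho> \<bullet>\<^sub>p \<tau>"]) (auto simp: image_path_concat composable_def intro!: concat_in)
qed

text \<open>(S3) closes the square but places only \<rho>' in a pixel; that pixel is
  \<open>X\<close>, since \<rho>' starts where \<tau> ends. For the other side \<tau>', (S1) is
  decisive: a path equivalent to one inside \<open>X\<close> stays inside \<open>X\<close>.\<close>

lemma reachable_in_confluent:
  assumes "X \<in> P" "reachable_in T X a b" "reachable_in T X a c"
  shows "\<exists>d. reachable_in T X b d \<and> reachable_in T X c d"
proof -
  obtain \<rho> \<tau> where \<rho>: "\<rho> \<in> paths T" "\<rho> 0 = a" "\<rho> 1 = b" "im \<rho> \<subseteq> X"
    and \<tau>: "\<tau> \<in> paths T" "\<tau> 0 = a" "\<tau> 1 = c" "im \<tau> \<subseteq> X"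
    using assms by (auto simp: reachable_in_def)
  obtain \<rho>' \<tau>' where *: "\<rho>' \<in> paths T" "\<tau>' \<in> paths T" "in_pixel P (im \<rho>')" "composable \<tau> \<rho>'"
    "composable \<rho> \<tau>'" "path_equiv T (\<tau> \<bullet>\<^sub>p \<rho>') (\<rho> \<bullet>\<^sub>p \<tau>')"
    using screen_ore[of \<rho> \<tau>] assms(1) \<rho> \<tau> by (auto simp: in_pixel_def)
  have "\<tau> 1 \<in> X" using \<tau> by auto
  then have "\<rho>' 0 \<in> X" using *(4) by (simp add: composable_def)
  then have \<rho>': "im \<rho>' \<subseteq> X"
    using in_pixel_start[OF *(3) assms(1), of "\<rho>' 0"] by simp
  have "im (\<tau> \<bullet>\<^sub>p \<rho>') \<subseteq> X" using \<rho>' \<tau> * by (simp add: image_path_concat)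
  then have "im (\<rho> \<bullet>\<^sub>p \<tau>') \<subseteq> X"
    using pixel_paths_equiv_iff[OF assms(1)] path_equiv_in[OF *(6)] path_equiv_ends[OF *(6)] *(6) by blast
  then have "im \<tau>' \<subseteq> X" using * by (simp add: image_path_concat)
  moreover have "\<rho>' 1 = \<tau>' 1" using path_equiv_ends[OF *(6)] by simp
  ultimately show ?thesis
    using \<rho>' * \<rho> \<tau> by (auto simp: reachable_in_def composable_def)
qed

lemma reachable_in_coconfluent:
  assumes "X \<in> P" "reachable_in T X b a" "reachable_in T X c a"
  shows "\<exists>d. reachable_in T X d b \<and> reachable_in T X d c"
proof -
  obtain \<rho> \<tau> where \<rho>: "\<rho> \<in> paths T" "\<rho> 0 = b" "\<rho> 1 = a" "im \<rho> \<subseteq> X"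
    and \<tau>: "\<tau> \<in> paths T" "\<tau> 0 = c" "\<tau> 1 = a" "im \<tau> \<subseteq> X"
    using assms by (auto simp: reachable_in_def)
  obtain \<rho>' \<tau>' where *: "\<rho>' \<in> paths T" "\<tau>' \<in> paths T" "in_pixel P (im \<rho>')" "composable \<tau>' \<rho>"
    "composable \<rho>' \<tau>" "path_equiv T (\<tau>' \<bullet>\<^sub>p \<rho>) (\<rho>' \<bullet>\<^sub>p \<tau>)"
    using screen_ore_dual[of \<rho> \<tau>] assms(1) \<rho> \<tau> by (auto simp: in_pixel_def)
  have "\<tau> 0 \<in> X" using \<tau> by auto
  then have "\<rho>' 1 \<in> X" using *(5) by (simp add: composable_def)
  then have \<rho>': "im \<rho>' \<subseteq> X"
    using in_pixel_start[OF *(3) assms(1), of "\<rho>' 1"] by simp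
  have "im (\<rho>' \<bullet>\<^sub>p \<tau>) \<subseteq> X" using \<rho>' \<tau> * by (simp add: image_path_concat)
  then have "im (\<tau>' \<bullet>\<^sub>p \<rho>) \<subseteq> X"
    using pixel_paths_equiv_iff[OF assms(1)] path_equiv_in[OF *(6)] path_equiv_ends[OF *(6)]
      path_equiv_sym[OF *(6)] by metis
  then have "im \<tau>' \<subseteq> X" using * by (simp add: image_path_concat)
  moreover have "\<rho>' 0 = \<tau>' 0" using path_equiv_ends[OF *(6)] by simp
  ultimately show ?thesis
    using \<rho>' * \<rho> \<tau> by (auto simp: reachable_in_def composable_def)
qed

lemma pixel_zigzag:
  assumes "X \<in> P" "a \<in> X" "b \<in> X"
  shows "(\<lambda>a b. reachable_in T X a b \<or> reachable_in T X b a)\<^sup>*\<^sup>* a b" (is "?R\<^sup>*\<^sup>* a b")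
proof -
  have "walk_connected T X a b"
  proof -
    have "\<forall>X\<in>P. \<forall>x\<in>X. \<forall>y\<in>X. walk_connected T X x y"
      using screen unfolding is_screen_def by (elim conjE)
    then show ?thesis using assms by blast
  qed
  then obtain n \<gamma> where \<gamma>: "\<And>i. i \<le> 2 * n \<Longrightarrow> \<gamma> i \<in> paths T \<and> im (\<gamma> i) \<subseteq> X"
    and w: "(let w = (\<lambda>i::nat. if even i then \<gamma> i else path_reverse (\<gamma> i)) in
        w 0 0 = a \<and> w (2 * n) 1 = b \<and> (\<forall>i<2 * n. composable (w i) (w (Suc i))))"
    unfolding walk_connected_def by blast
  define w where "w i = (if even i then \<gamma> i else path_reverse (\<gamma> i))" for i :: nat
  have ends: "w 0 0 = a" "w (2 * n) 1 = b" and comp: "\<And>i. i < 2 * n \<Longrightarrow> w i 1 = w (Suc i) 0"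
    using w unfolding Let_def w_def composable_def by auto
  \<comment> \<open>Odd pieces are run backwards, so each of them gives reachability in the reverse
    direction.\<close>
  have step: "?R (w i 0) (w i 1)" if "i \<le> 2 * n" for i
    using \<gamma>[OF that] unfolding w_def reachable_in_def by auto
  have "i \<le> 2 * n \<Longrightarrow> ?R\<^sup>*\<^sup>* a (w i 1)" for i
  proof (induction i)
    case 0
    then show ?case using step[of 0] ends by auto
  next
    case (Suc i)
    then have "?R\<^sup>*\<^sup>* a (w (Suc i) 0)" using comp[of i] by simp
    then show ?case using step[OF Suc.prems] by (rule rtranclp.rtrancl_into_rtrancl)
  qed
  then show ?thesis using ends by auto
qed

lemma pixel_directed:
  assumes "X \<in> P" "finite A" "A \<noteq> {}" "A \<subseteq> X"
  shows "\<exists>d. \<forall>a\<in>A. reachable_in T X a d"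
proof (rule finite_directed[OF assms(2,3) reachable_in_trans reachable_in_confluent[OF assms(1)]])
  fix a b assume "a \<in> A" "b \<in> A"
  then have "a \<in> X" "b \<in> X" using assms by auto
  then show "\<exists>d. reachable_in T X a d \<and> reachable_in T X b d"
    by (intro zigzag_joinable[OF reachable_in_refl reachable_in_trans
          reachable_in_confluent[OF assms(1)] pixel_zigzag] assms(1))
qed

lemma pixel_codirected:
  assumes "X \<in> P" "finite A" "A \<noteq> {}" "A \<subseteq> X"
  shows "\<exists>d. \<forall>a\<in>A. reachable_in T X d a"
proof (rule finite_directed[OF assms(2,3) reachable_in_trans reachable_in_coconfluent[OF assms(1)]])
  fix a b assume "a \<in> A" "b \<in> A"
  then have "a \<in> X" "b \<in> X" using assms by auto
  \<comment> \<open>The zigzag relation is symmetric, so it is also the zigzag relation of reversed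
    reachability.\<close>
  have "(\<lambda>a b. reachable_in T X b a \<or> reachable_in T X a b)\<^sup>*\<^sup>* a b"
    using pixel_zigzag[OF assms(1) \<open>a \<in> X\<close> \<open>b \<in> X\<close>] by (simp add: disj_commute)
  then show "\<exists>d. reachable_in T X d a \<and> reachable_in T X d b"
    by (intro zigzag_joinable[OF reachable_in_refl reachable_in_trans
          reachable_in_coconfluent[OF assms(1)]] assms \<open>a \<in> X\<close>)
qed

end

section \<open>Pixel morphisms form an Ore class\<close>

text \<open>The zero morphism of the zero object is added because it is the identity there.\<close>

definition pixel_mors ::
  "'a triple \<Rightarrow> 'a set set \<Rightarrow> 'a option \<Rightarrow> 'a option \<Rightarrow> ('a, 'k::{comm_ring,comm_monoid_mult}) lin_path set" where
  "pixel_mors T P x y = {path_mor T \<rho> | \<rho>. \<rho> \<in> paths_between T x y \<and> in_pixel P (im \<rho>)} \<union>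
     (if x = None \<and> y = None then {0} else {})"

lemma pixel_morsE:
  assumes "\<sigma> \<in> pixel_mors T P x y"
  obtains (path) \<rho> where "\<rho> \<in> paths_between T x y" "in_pixel P (im \<rho>)" "\<sigma> = path_mor T \<rho>"
    | (zero) "x = None" "y = None" "\<sigma> = 0"
  using assms by (auto simp: pixel_mors_def split: if_splits)

lemma pixel_morsI: "\<lbrakk>\<rho> \<in> paths_between T x y; in_pixel P (im \<rho>)\<rbrakk> \<Longrightarrow> path_mor T \<rho> \<in> pixel_mors T P x y"
  by (auto simp: pixel_mors_def)

context screened_triple begin

lemma in_pixel_concat:
  assumes "in_pixel P (im \<gamma>)" "in_pixel P (im \<delta>)" "composable \<gamma> \<delta>"
  shows "in_pixel P (im (\<gamma> \<bullet>\<^sub>p \<delta>))"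
proof -
  obtain X where X: "X \<in> P" "im \<gamma> \<subseteq> X" using assms by (auto simp: in_pixel_def)
  then have "\<gamma> 1 \<in> X" by auto
  then have "\<delta> 0 \<in> X" using assms by (simp add: composable_def)
  then have "im \<delta> \<subseteq> X" using in_pixel_start[OF assms(2) X(1), of "\<delta> 0"] by simp
  then show ?thesis using X assms by (auto simp: in_pixel_def image_path_concat)
qed

end

locale screened_ideal = screened_triple T P for T :: "'a triple" and P :: "'a set set" +
  fixes I :: "'a option \<Rightarrow> 'a option \<Rightarrow> ('a, 'k::{comm_ring,comm_monoid_mult}) lin_path set"
  assumes path_ideal: "is_ideal (path_category T) I"
begin

abbreviation "\<C> \<equiv> path_category T :: ('a option, ('a, 'k) lin_path) category"
abbreviation "W \<equiv> pixel_mors T P :: 'a option \<Rightarrow> 'a option \<Rightarrow> ('a, 'k) lin_path set"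

sublocale pre: preadditive_ideal \<C> I
  using preadditive_path_category path_ideal
  by (simp add: preadditive_ideal_def preadditive_ideal_axioms_def)

lemma path_mor_in_Hom: "\<rho> \<in> paths_between T x y \<Longrightarrow> path_mor T \<rho> \<in> Hom \<C> x y"
  unfolding path_mor_def by (rule scaled_path_in_Hom)

lemma pixel_mors_sub: "\<sigma> \<in> W x y \<Longrightarrow> \<sigma> \<in> Hom \<C> x y"
proof (erule pixel_morsE)
  show "\<sigma> \<in> Hom \<C> x y" if "\<rho> \<in> paths_between T x y" "\<sigma> = path_mor T \<rho>" for \<rho>
    unfolding that(2) using that(1) by (rule path_mor_in_Hom)
qed simp

lemma pixel_mors_ident:
  assumes "x \<in> Obj \<C>"
  shows "Ident \<C> x \<in> W x x"
proof (cases x)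
  case (Some a)
  then show ?thesis
    using assms point_pixel[of a] const_path_in[of a]
    by (auto intro!: pixel_morsI simp: paths_between_def in_pixel_def)
qed (simp add: pixel_mors_def)

lemma path_mor_concat:
  assumes "\<rho> \<in> paths_between T x y" "\<tau> \<in> paths_between T y z"
  shows "lin_path_comp T (path_mor T \<tau>) (path_mor T \<rho> :: ('a, 'k) lin_path) = path_mor T (\<rho> \<bullet>\<^sub>p \<tau>)"
  by (simp add: path_mor_def lin_path_comp_scaled(1)[OF assms])

lemma paths_between_concat_in_pixel:
  assumes "\<rho> \<in> paths_between T x y" "in_pixel P (im \<rho>)" "\<tau> \<in> paths_between T y z" "in_pixel P (im \<tau>)"
  shows "in_pixel P (im (\<rho> \<bullet>\<^sub>p \<tau>))"
  using assms by (intro in_pixel_concat) (auto simp: paths_between_def composable_def)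

lemma pixel_mors_comp:
  assumes "\<sigma> \<in> W x y" "\<tau> \<in> W y z"
  shows "Comp \<C> x y z \<tau> \<sigma> \<in> W x z"
  using assms(1)
proof (cases rule: pixel_morsE)
  case \<rho>: (path \<rho>)
  show ?thesis using assms(2)
  proof (cases rule: pixel_morsE)
    case \<rho>': (path \<rho>')
    have "path_mor T (\<rho> \<bullet>\<^sub>p \<rho>') \<in> W x z"
      using \<rho> \<rho>' by (intro pixel_morsI lin_path_comp_scaled(2) paths_between_concat_in_pixel)
    then show ?thesis by (simp add: \<rho>(3) \<rho>'(3) path_mor_concat[OF \<rho>(1) \<rho>'(1)])
  qed (use \<rho> in \<open>simp add: paths_between_def\<close>)
next
  case zero
  show ?thesis using assms(2)
    by (cases rule: pixel_morsE) (use zero in \<open>simp_all add: paths_between_def pixel_mors_def\<close>)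
qed

text \<open>Base case of the linear induction: a zero morphism and the identity of \<open>y\<close>
  close a square over any \<sigma>.\<close>

lemma pixel_ore_zero:
  assumes "x \<in> Obj \<C>" "x' \<in> Obj \<C>" "y \<in> Obj \<C>"
  shows "pre.ore_square W x x' y \<sigma> 0"
    and "preadditive_category.ore_square (opposite \<C>) (\<lambda>x y. W y x) x x' y \<sigma> 0"
proof -
  interpret op: preadditive_category "opposite \<C>" by (rule pre.preadditive_opposite)
  have "0 \<in> Hom \<C> x' y" "0 \<in> Hom \<C> y x'" "Ident \<C> y \<in> W y y"
    using assms pre.zero_in pixel_mors_ident by blast+
  then show "pre.ore_square W x x' y \<sigma> 0" "op.ore_square (\<lambda>x y. W y x) x x' y \<sigma> 0"
    unfolding pre.ore_square_def op.ore_square_def opposite_simps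
    using assms(3) by (metis lin_path_comp_zero path_category_simps(3))+
qed

text \<open>The square of (S3) is taken with the coefficient on \<gamma>', so that the opposite side
  \<rho>' remains a pixel morphism with coefficient 1.\<close>

lemma pixel_ore_scaled_path:
  assumes "\<rho> \<in> paths_between T x x'" "in_pixel P (im \<rho>)" "\<gamma> \<in> paths_between T x y"
  shows "pre.ore_square W x x' y (path_mor T \<rho>) (scaled_path T a \<gamma>)"
proof -
  have paths: "\<rho> \<in> paths T" "\<gamma> \<in> paths T" "\<rho> 0 = \<gamma> 0"
    using assms by (auto simp: paths_between_def)
  obtain \<rho>' \<gamma>' where *: "\<rho>' \<in> paths T" "\<gamma>' \<in> paths T" "in_pixel P (im \<rho>')" "composable \<gamma> \<rho>'"
    "composable \<rho> \<gamma>'" "path_equiv T (\<gamma> \<bullet>\<^sub>p \<rho>') (\<rho> \<bullet>\<^sub>p \<gamma>')"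
    using screen_ore[OF paths assms(2)] .
  define y' where "y' = Some (\<rho>' 1)"
  have y': "y' \<in> Obj \<C>" "\<rho>' \<in> paths_between T y y'" "\<gamma>' \<in> paths_between T x' y'"
    using * assms path_at[of \<rho>' 1] path_equiv_ends[OF *(6)]
    by (auto simp: y'_def paths_between_def composable_def)
  have "Comp \<C> x x' y' (scaled_path T a \<gamma>') (path_mor T \<rho>) = scaled_path T a (\<rho> \<bullet>\<^sub>p \<gamma>')"
    "Comp \<C> x y y' (path_mor T \<rho>') (scaled_path T a \<gamma>) = scaled_path T a (\<gamma> \<bullet>\<^sub>p \<rho>')"
    by (simp_all add: path_mor_def lin_path_comp_scaled(1)[OF assms(1) y'(3)]
        lin_path_comp_scaled(1)[OF assms(3) y'(2)])
  then have "Comp \<C> x x' y' (scaled_path T a \<gamma>') (path_mor T \<rho>) =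
      Comp \<C> x y y' (path_mor T \<rho>') (scaled_path T a \<gamma>)"
    by (simp add: scaled_path_cong[OF *(6)])
  then show ?thesis
    unfolding pre.ore_square_def
    using y' pixel_morsI[OF y'(2) *(3)] scaled_path_in_Hom[OF y'(3)] by blast
qed

lemma pixel_ore_opposite_scaled_path:
  assumes "\<rho> \<in> paths_between T x' x" "in_pixel P (im \<rho>)" "\<gamma> \<in> paths_between T y x"
  shows "preadditive_category.ore_square (opposite \<C>) (\<lambda>x y. W y x) x x' y
    (path_mor T \<rho>) (scaled_path T a \<gamma>)"
proof -
  interpret op: preadditive_category "opposite \<C>" by (rule pre.preadditive_opposite)
  have paths: "\<rho> \<in> paths T" "\<gamma> \<in> paths T" "\<rho> 1 = \<gamma> 1"
    using assms by (auto simp: paths_between_def)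
  obtain \<rho>' \<gamma>' where *: "\<rho>' \<in> paths T" "\<gamma>' \<in> paths T" "in_pixel P (im \<rho>')" "composable \<gamma>' \<rho>"
    "composable \<rho>' \<gamma>" "path_equiv T (\<gamma>' \<bullet>\<^sub>p \<rho>) (\<rho>' \<bullet>\<^sub>p \<gamma>)"
    using screen_ore_dual[OF paths assms(2)] .
  define y' where "y' = Some (\<rho>' 0)"
  have y': "y' \<in> Obj \<C>" "\<rho>' \<in> paths_between T y' y" "\<gamma>' \<in> paths_between T y' x'"
    using * assms path_at[of \<rho>' 0] path_equiv_ends[OF *(6)]
    by (auto simp: y'_def paths_between_def composable_def)
  have "Comp \<C> y' x' x (path_mor T \<rho>) (scaled_path T a \<gamma>') = scaled_path T a (\<gamma>' \<bullet>\<^sub>p \<rho>)"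
    "Comp \<C> y' y x (scaled_path T a \<gamma>) (path_mor T \<rho>') = scaled_path T a (\<rho>' \<bullet>\<^sub>p \<gamma>)"
    by (simp_all add: path_mor_def lin_path_comp_scaled(1)[OF y'(3) assms(1)]
        lin_path_comp_scaled(1)[OF y'(2) assms(3)])
  then have "Comp \<C> y' x' x (path_mor T \<rho>) (scaled_path T a \<gamma>') =
      Comp \<C> y' y x (scaled_path T a \<gamma>) (path_mor T \<rho>')"
    by (simp add: scaled_path_cong[OF *(6)])
  then show ?thesis
    unfolding op.ore_square_def opposite_simps
    using y' pixel_morsI[OF y'(2) *(3)] scaled_path_in_Hom[OF y'(3)] by blast
qed

text \<open>Linear induction on \<open>f\<close>. The sum step needs squares between two pixel
  morphisms, and these are the case of a single path with coefficient 1.\<close>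

lemma pixel_ore:
  assumes obj: "x \<in> Obj \<C>" "x' \<in> Obj \<C>" "y \<in> Obj \<C>" and \<sigma>: "\<sigma> \<in> W x x'" and "f \<in> Hom \<C> x y"
  shows "pre.ore_square W x x' y \<sigma> f"
proof -
  have scaled: "pre.ore_square W x x' y \<sigma> (scaled_path T a \<gamma>)"
    if "\<sigma> \<in> W x x'" "\<gamma> \<in> paths_between T x y" for x x' y \<sigma> \<gamma> a
    using that(1)
  proof (cases rule: pixel_morsE)
    case (path \<rho>)
    then show ?thesis using pixel_ore_scaled_path that(2) by blast
  \<comment> \<open>The extra zero morphism lives at \<open>None\<close>, where no path \<gamma> can
    start.\<close>
  qed (use that in \<open>simp add: paths_between_def\<close>)
  have W_ore: "pre.ore_square W x x' y \<sigma> \<tau>"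
    if "x \<in> Obj \<C>" "x' \<in> Obj \<C>" "y \<in> Obj \<C>" "\<sigma> \<in> W x x'" "\<tau> \<in> W x y" for x x' y \<sigma> \<tau>
    using that(5)
  proof (cases rule: pixel_morsE)
    case (path \<rho>)
    then show ?thesis using scaled[OF that(4) path(1), of 1] by (simp add: path_mor_def)
  next
    case zero
    then show ?thesis using pixel_ore_zero(1)[OF that(1,2,3)] by simp
  qed
  show ?thesis using assms(5)
  proof (induction rule: Hom_path_category_induct)
    case zero
    show ?case using obj by (rule pixel_ore_zero)
  next
    case (scaled_path \<gamma> a)
    show ?case using scaled[OF \<sigma> scaled_path] .
  next
    case (add f g)
    show ?case
      by (rule pre.ore_square_add[OF _ pixel_mors_comp W_ore obj \<sigma> add.hyps add.IH])
        (use pixel_mors_sub in blast)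
  qed
qed

lemma pixel_ore_opposite:
  assumes obj: "x \<in> Obj \<C>" "x' \<in> Obj \<C>" "y \<in> Obj \<C>" and \<sigma>: "\<sigma> \<in> W x' x" and "f \<in> Hom \<C> y x"
  shows "preadditive_category.ore_square (opposite \<C>) (\<lambda>x y. W y x) x x' y \<sigma> f"
proof -
  interpret op: preadditive_category "opposite \<C>" by (rule pre.preadditive_opposite)
  have scaled: "op.ore_square (\<lambda>x y. W y x) x x' y \<sigma> (scaled_path T a \<gamma>)"
    if "\<sigma> \<in> W x' x" "\<gamma> \<in> paths_between T y x" for x x' y \<sigma> \<gamma> a
    using that(1)
  proof (cases rule: pixel_morsE)
    case (path \<rho>)
    then show ?thesis using pixel_ore_opposite_scaled_path that(2) by blast
  qed (use that in \<open>simp add: paths_between_def\<close>)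
  have W_ore: "op.ore_square (\<lambda>x y. W y x) x x' y \<sigma> \<tau>"
    if "x \<in> Obj \<C>" "x' \<in> Obj \<C>" "y \<in> Obj \<C>" "\<sigma> \<in> W x' x" "\<tau> \<in> W y x" for x x' y \<sigma> \<tau>
    using that(5)
  proof (cases rule: pixel_morsE)
    case (path \<rho>)
    then show ?thesis using scaled[OF that(4) path(1), of 1] by (simp add: path_mor_def)
  next
    case zero
    then show ?thesis using pixel_ore_zero(2)[OF that(1,2,3)] by simp
  qed
  show ?thesis using assms(5)
  proof (induction rule: Hom_path_category_induct)
    case zero
    show ?case using obj by (rule pixel_ore_zero)
  next
    case (scaled_path \<gamma> a)
    show ?case using scaled[OF \<sigma> scaled_path] .
  next
    case (add f g)
    show ?case
    \<comment> \<open>The addition argument is reused in the opposite category, with the two factors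
      of a composite exchanged.\<close>
    proof (rule op.ore_square_add[of "\<lambda>x y. W y x"])
      show "W y x \<subseteq> Hom (opposite \<C>) x y" for x y
        unfolding opposite_simps using pixel_mors_sub by blast
      show "Comp (opposite \<C>) x y z \<tau> \<sigma> \<in> W z x" if "\<sigma> \<in> W y x" "\<tau> \<in> W z y" for x y z \<sigma> \<tau>
        unfolding opposite_simps using pixel_mors_comp[OF that(2,1)] .
      show "op.ore_square (\<lambda>x y. W y x) x x' y \<sigma> \<tau>"
        if "x \<in> Obj (opposite \<C>)" "x' \<in> Obj (opposite \<C>)" "y \<in> Obj (opposite \<C>)"
          "\<sigma> \<in> W x' x" "\<tau> \<in> W y x" for x x' y \<sigma> \<tau>
        using W_ore that unfolding opposite_simps .
    qed (use obj \<sigma> add in \<open>simp_all only: opposite_simps\<close>)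
  qed
qed

sublocale ore: ore_class \<C> I W
  by unfold_locales
    (rule pixel_mors_sub pixel_mors_ident pixel_mors_comp pixel_ore pixel_ore_opposite; assumption)+

end

section \<open>The completion is the saturation along pixel morphisms\<close>

context path_triple begin

text \<open>Passes from the bracketing produced by composing with prolonged pixel paths to the one
  in which a given equivalence of the inner triple can be substituted by axiom (f).\<close>

lemma path_equiv_concat_five:
  assumes "p \<in> paths T" "a \<in> paths T" "b \<in> paths T" "c \<in> paths T" "q \<in> paths T"
    and "composable p a" "composable a b" "composable b c" "composable c q"
  shows "path_equiv T (((p \<bullet>\<^sub>p a) \<bullet>\<^sub>p b) \<bullet>\<^sub>p (c \<bullet>\<^sub>p q)) (p \<bullet>\<^sub>p (a \<bullet>\<^sub>p b \<bullet>\<^sub>p c) \<bullet>\<^sub>p q)"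
proof -
  note [simp] = composable_def concat_in path_equiv_refl
  have "path_equiv T (((p \<bullet>\<^sub>p a) \<bullet>\<^sub>p b) \<bullet>\<^sub>p (c \<bullet>\<^sub>p q)) ((p \<bullet>\<^sub>p a) \<bullet>\<^sub>p b \<bullet>\<^sub>p c \<bullet>\<^sub>p q)"
    using assms by (intro path_equiv_concat_assoc) simp_all
  also have "path_equiv T \<dots> (p \<bullet>\<^sub>p a \<bullet>\<^sub>p b \<bullet>\<^sub>p c \<bullet>\<^sub>p q)"
    using assms by (intro path_equiv_concat_assoc) simp_all
  also have "path_equiv T \<dots> (p \<bullet>\<^sub>p a \<bullet>\<^sub>p (b \<bullet>\<^sub>p c) \<bullet>\<^sub>p q)"
    using assms by (intro path_equiv_concat path_equiv_sym[OF path_equiv_concat_assoc]) simp_all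
  also have "path_equiv T \<dots> (p \<bullet>\<^sub>p (a \<bullet>\<^sub>p b \<bullet>\<^sub>p c) \<bullet>\<^sub>p q)"
    using assms by (intro path_equiv_concat path_equiv_sym[OF path_equiv_concat_assoc]) simp_all
  finally show ?thesis .
qed

lemma path_equiv_concat_outer:
  assumes "path_equiv T \<sigma> \<sigma>'" "path_equiv T \<tau> \<tau>'" "\<gamma> \<in> paths T" "composable \<sigma> \<gamma>" "composable \<gamma> \<tau>"
  shows "path_equiv T ((\<sigma> \<bullet>\<^sub>p \<gamma>) \<bullet>\<^sub>p \<tau>) ((\<sigma>' \<bullet>\<^sub>p \<gamma>) \<bullet>\<^sub>p \<tau>')"
  using assms by (intro path_equiv_concat path_equiv_refl) (simp_all add: composable_def)

lemma lin_path_comp_sandwich: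
  assumes "\<sigma> \<in> paths_between T w x" "\<tau> \<in> paths_between T y z"
    "\<And>i. i < n \<Longrightarrow> \<gamma> i \<in> paths_between T x y"
  shows "lin_path_comp T (path_mor T \<tau>) (lin_path_comp T (\<Sum>i<n. scaled_path T (cs i) (\<gamma> i)) (path_mor T \<sigma>)) =
    (\<Sum>i<n::nat. scaled_path T (cs i) ((\<sigma> \<bullet>\<^sub>p \<gamma> i) \<bullet>\<^sub>p \<tau>))"
  unfolding lin_path_comp_sum_left lin_path_comp_sum_right
proof (rule sum.cong)
  fix i assume "i \<in> {..<n}"
  then have \<gamma>: "\<gamma> i \<in> paths_between T x y" using assms by simp
  show "lin_path_comp T (path_mor T \<tau>) (lin_path_comp T (scaled_path T (cs i) (\<gamma> i)) (path_mor T \<sigma>)) =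
      scaled_path T (cs i) ((\<sigma> \<bullet>\<^sub>p \<gamma> i) \<bullet>\<^sub>p \<tau>)"
    by (simp add: path_mor_def lin_path_comp_scaled(1)[OF assms(1) \<gamma>]
        lin_path_comp_scaled(1)[OF lin_path_comp_scaled(2)[OF assms(1) \<gamma>] assms(2)])
qed simp

end

context screened_triple begin

text \<open>Since a pixel is directed and its parallel paths are equivalent, the pixel paths witnessing
  finitely many equivalences can be replaced by common ones.\<close>

lemma screen_equiv_paths_uniform:
  assumes "0 < m" "\<And>i. i < m \<Longrightarrow> \<gamma> i \<in> paths_between T x y" "\<And>i. i < m \<Longrightarrow> \<delta> i \<in> paths_between T x' y'"
    and "\<And>i. i < m \<Longrightarrow> screen_equiv_paths T P (\<gamma> i) (\<delta> i)"
  obtains \<sigma> w \<sigma>' \<tau> z \<tau>' where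
    "\<sigma> \<in> paths_between T w x" "\<sigma>' \<in> paths_between T w x'" "in_pixel P (im \<sigma>)" "in_pixel P (im \<sigma>')"
    "\<tau> \<in> paths_between T y z" "\<tau>' \<in> paths_between T y' z" "in_pixel P (im \<tau>)" "in_pixel P (im \<tau>')"
    "\<forall>i<m::nat. path_equiv T ((\<sigma> \<bullet>\<^sub>p \<gamma> i) \<bullet>\<^sub>p \<tau>) ((\<sigma>' \<bullet>\<^sub>p \<delta> i) \<bullet>\<^sub>p \<tau>')"
proof -
  have "\<forall>i. \<exists>\<rho>1 \<rho>2 \<rho>3 \<rho>4. i < m \<longrightarrow> \<rho>1 \<in> paths T \<and> \<rho>2 \<in> paths T \<and> \<rho>3 \<in> paths T \<and> \<rho>4 \<in> paths T \<and>
      in_pixel P (im \<rho>1 \<union> im \<rho>2) \<and> in_pixel P (im \<rho>3 \<union> im \<rho>4) \<and>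
      composable \<rho>1 (\<gamma> i) \<and> composable (\<gamma> i) \<rho>3 \<and> composable \<rho>2 (\<delta> i) \<and> composable (\<delta> i) \<rho>4 \<and>
      path_equiv T (\<rho>1 \<bullet>\<^sub>p \<gamma> i \<bullet>\<^sub>p \<rho>3) (\<rho>2 \<bullet>\<^sub>p \<delta> i \<bullet>\<^sub>p \<rho>4)"
    using assms(4) unfolding screen_equiv_paths_def by blast
  then obtain \<rho>1 \<rho>2 \<rho>3 \<rho>4 where \<rho>: "\<And>i. i < m \<Longrightarrow>
      \<rho>1 i \<in> paths T \<and> \<rho>2 i \<in> paths T \<and> \<rho>3 i \<in> paths T \<and> \<rho>4 i \<in> paths T \<and>
      in_pixel P (im (\<rho>1 i) \<union> im (\<rho>2 i)) \<and> in_pixel P (im (\<rho>3 i) \<union> im (\<rho>4 i)) \<and>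
      composable (\<rho>1 i) (\<gamma> i) \<and> composable (\<gamma> i) (\<rho>3 i) \<and> composable (\<rho>2 i) (\<delta> i) \<and>
      composable (\<delta> i) (\<rho>4 i) \<and> path_equiv T (\<rho>1 i \<bullet>\<^sub>p \<gamma> i \<bullet>\<^sub>p \<rho>3 i) (\<rho>2 i \<bullet>\<^sub>p \<delta> i \<bullet>\<^sub>p \<rho>4 i)"
    by metis
  \<comment> \<open>Equivalent paths share endpoints: \<rho>1 and \<rho>2 start together, \<rho>3
    and \<rho>4 end together. Hence one \<open>p i\<close> and one \<open>q i\<close> can prolong
    both sides below.\<close>
  have eq: "path_equiv T (\<rho>1 i \<bullet>\<^sub>p \<gamma> i \<bullet>\<^sub>p \<rho>3 i) (\<rho>2 i \<bullet>\<^sub>p \<delta> i \<bullet>\<^sub>p \<rho>4 i)"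
    "\<rho>1 i 0 = \<rho>2 i 0" "\<rho>3 i 1 = \<rho>4 i 1" if "i < m" for i
    using \<rho>[OF that] path_equiv_ends[of "\<rho>1 i \<bullet>\<^sub>p \<gamma> i \<bullet>\<^sub>p \<rho>3 i" "\<rho>2 i \<bullet>\<^sub>p \<delta> i \<bullet>\<^sub>p \<rho>4 i"] by auto
  obtain a b a' b' where ab: "x = Some a" "y = Some b" "x' = Some a'" "y' = Some b'"
    using assms(2,3)[OF \<open>0 < m\<close>] by (auto simp: paths_between_def)
  have ends: "\<rho>1 i 1 = a" "\<rho>2 i 1 = a'" "\<rho>3 i 0 = b" "\<rho>4 i 0 = b'"
    "\<gamma> i 0 = a" "\<gamma> i 1 = b" "\<delta> i 0 = a'" "\<delta> i 1 = b'" "\<gamma> i \<in> paths T" "\<delta> i \<in> paths T"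
    if "i < m" for i
    using \<rho>[OF that] assms(2,3)[OF that] ab by (auto simp: paths_between_def composable_def)
  have "a \<in> points T" "b \<in> points T"
    using path_at[of "\<gamma> 0" 0] path_at[of "\<gamma> 0" 1] ends[OF \<open>0 < m\<close>] by simp_all
  then obtain X Y where XY: "X \<in> P" "a \<in> X" "Y \<in> P" "b \<in> Y"
    using point_pixel by blast
  \<comment> \<open>Every \<rho>1 ends at \<open>a\<close> and every \<rho>3 starts at
    \<open>b\<close>, so the pixels containing the witnesses do not depend on
    \<open>i\<close>.\<close>
  have im: "im (\<rho>1 i) \<union> im (\<rho>2 i) \<subseteq> X" "im (\<rho>3 i) \<union> im (\<rho>4 i) \<subseteq> Y" if "i < m" for i
    using in_pixel_start[of "im (\<rho>1 i) \<union> im (\<rho>2 i)" X a] in_pixel_start[of "im (\<rho>3 i) \<union> im (\<rho>4 i)" Y b]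
      \<rho>[OF that] XY ends(1,3)[OF that] by (metis Un_iff atLeastAtMost_iff imageI order_refl zero_le_one)+
  have "(\<lambda>i. \<rho>1 i 0) ` {..<m} \<subseteq> X" "(\<lambda>i. \<rho>3 i 1) ` {..<m} \<subseteq> Y"
    using im by (auto simp: image_subset_iff)
  then have "\<exists>w. \<forall>i\<in>{..<m}. reachable_in T X w (\<rho>1 i 0)"
    "\<exists>z. \<forall>i\<in>{..<m}. reachable_in T Y (\<rho>3 i 1) z"
    using pixel_codirected[OF XY(1), of "(\<lambda>i. \<rho>1 i 0) ` {..<m}"]
      pixel_directed[OF XY(3), of "(\<lambda>i. \<rho>3 i 1) ` {..<m}"] \<open>0 < m\<close>
    by (simp_all add: lessThan_empty_iff)
  then obtain w z where "\<And>i. i < m \<Longrightarrow> reachable_in T X w (\<rho>1 i 0)"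
    "\<And>i. i < m \<Longrightarrow> reachable_in T Y (\<rho>3 i 1) z"
    unfolding Ball_def lessThan_iff by blast
  then obtain p q where
    p: "\<And>i. i < m \<Longrightarrow> p i \<in> paths T \<and> p i 0 = w \<and> p i 1 = \<rho>1 i 0 \<and> im (p i) \<subseteq> X" and
    q: "\<And>i. i < m \<Longrightarrow> q i \<in> paths T \<and> q i 0 = \<rho>3 i 1 \<and> q i 1 = z \<and> im (q i) \<subseteq> Y"
    unfolding reachable_in_def by metis
  let ?\<sigma> = "\<lambda>i. p i \<bullet>\<^sub>p \<rho>1 i" and ?\<sigma>' = "\<lambda>i. p i \<bullet>\<^sub>p \<rho>2 i"
    and ?\<tau> = "\<lambda>i. \<rho>3 i \<bullet>\<^sub>p q i" and ?\<tau>' = "\<lambda>i. \<rho>4 i \<bullet>\<^sub>p q i"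
  have path: "?\<sigma> i \<in> paths T" "?\<sigma>' i \<in> paths T" "?\<tau> i \<in> paths T" "?\<tau>' i \<in> paths T"
    and sub: "im (?\<sigma> i) \<subseteq> X" "im (?\<sigma>' i) \<subseteq> X" "im (?\<tau> i) \<subseteq> Y" "im (?\<tau>' i) \<subseteq> Y" if "i < m" for i
    using \<rho>[OF that] p[OF that] q[OF that] eq[OF that] im[OF that]
    by (simp_all add: concat_in composable_def image_path_concat)
  \<comment> \<open>The prolonged witnesses are parallel paths in one pixel, so (S1) allows those of
    index 0 to replace all others.\<close>
  have fix0: "path_equiv T (?\<sigma> 0) (?\<sigma> i)" "path_equiv T (?\<sigma>' 0) (?\<sigma>' i)"
    "path_equiv T (?\<tau> 0) (?\<tau> i)" "path_equiv T (?\<tau>' 0) (?\<tau>' i)" if "i < m" for i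
    using pixel_paths_equiv_iff[OF XY(1), of "?\<sigma> 0" "?\<sigma> i"] pixel_paths_equiv_iff[OF XY(1), of "?\<sigma>' 0" "?\<sigma>' i"]
      pixel_paths_equiv_iff[OF XY(3), of "?\<tau> 0" "?\<tau> i"] pixel_paths_equiv_iff[OF XY(3), of "?\<tau>' 0" "?\<tau>' i"]
      path[OF that] sub[OF that] path[OF \<open>0 < m\<close>] sub[OF \<open>0 < m\<close>] ends[OF that] ends[OF \<open>0 < m\<close>]
      p[OF that] q[OF that] p[OF \<open>0 < m\<close>] q[OF \<open>0 < m\<close>]
    by simp_all
  have "path_equiv T ((?\<sigma> 0 \<bullet>\<^sub>p \<gamma> i) \<bullet>\<^sub>p ?\<tau> 0) ((?\<sigma>' 0 \<bullet>\<^sub>p \<delta> i) \<bullet>\<^sub>p ?\<tau>' 0)" if i: "i < m" for i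
  proof -
    have comp: "composable (p i) (\<rho>1 i)" "composable (p i) (\<rho>2 i)" "composable (\<rho>3 i) (q i)"
      "composable (\<rho>4 i) (q i)"
      using p[OF i] q[OF i] eq[OF i] by (simp_all add: composable_def)
    have "path_equiv T ((?\<sigma> 0 \<bullet>\<^sub>p \<gamma> i) \<bullet>\<^sub>p ?\<tau> 0) ((?\<sigma> i \<bullet>\<^sub>p \<gamma> i) \<bullet>\<^sub>p ?\<tau> i)"
      by (rule path_equiv_concat_outer[OF fix0(1,3)[OF i] ends(9)[OF i]])
        (simp_all add: composable_def ends[OF i] ends[OF \<open>0 < m\<close>])
    also have "path_equiv T \<dots> (p i \<bullet>\<^sub>p (\<rho>1 i \<bullet>\<^sub>p \<gamma> i \<bullet>\<^sub>p \<rho>3 i) \<bullet>\<^sub>p q i)"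
      using \<rho>[OF i] p[OF i] q[OF i] ends[OF i] comp by (intro path_equiv_concat_five) auto
    also have "path_equiv T \<dots> (p i \<bullet>\<^sub>p (\<rho>2 i \<bullet>\<^sub>p \<delta> i \<bullet>\<^sub>p \<rho>4 i) \<bullet>\<^sub>p q i)"
      using eq(1)[OF i] p[OF i] q[OF i] by (intro path_equiv_sandwich) (auto simp: composable_def)
    also have "path_equiv T \<dots> ((?\<sigma>' i \<bullet>\<^sub>p \<delta> i) \<bullet>\<^sub>p ?\<tau>' i)"
      using \<rho>[OF i] p[OF i] q[OF i] ends[OF i] comp
      by (intro path_equiv_sym[OF path_equiv_concat_five]) auto
    also have "path_equiv T \<dots> ((?\<sigma>' 0 \<bullet>\<^sub>p \<delta> i) \<bullet>\<^sub>p ?\<tau>' 0)"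
      by (rule path_equiv_concat_outer[OF fix0(2,4)[OF i, THEN path_equiv_sym] ends(10)[OF i]])
        (simp_all add: composable_def ends[OF i] ends[OF \<open>0 < m\<close>])
    finally show ?thesis .
  qed
  then show ?thesis
    by (intro that[of "?\<sigma> 0" "Some w" "?\<sigma>' 0" "?\<tau> 0" "Some z" "?\<tau>' 0"])
      (use path[OF \<open>0 < m\<close>] sub[OF \<open>0 < m\<close>] ends[OF \<open>0 < m\<close>] p[OF \<open>0 < m\<close>] q[OF \<open>0 < m\<close>] ab XY
        in \<open>auto simp: paths_between_def in_pixel_def\<close>)
qed

text \<open>The witnesses are \<sigma> and \<tau> on the side of \<gamma>, and constant paths at the
  outer endpoints on the other side.\<close>

lemma screen_equiv_sandwich:
  assumes "\<sigma> \<in> paths_between T w x" "in_pixel P (im \<sigma>)" "\<gamma> \<in> paths_between T x y"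
    "\<tau> \<in> paths_between T y z" "in_pixel P (im \<tau>)"
  shows "screen_equiv_paths T P \<gamma> ((\<sigma> \<bullet>\<^sub>p \<gamma>) \<bullet>\<^sub>p \<tau>)"
proof -
  have *: "\<sigma> \<in> paths T" "\<gamma> \<in> paths T" "\<tau> \<in> paths T" "\<sigma> 1 = \<gamma> 0" "\<gamma> 1 = \<tau> 0"
    using assms by (auto simp: paths_between_def)
  let ?\<gamma> = "(\<sigma> \<bullet>\<^sub>p \<gamma>) \<bullet>\<^sub>p \<tau>" and ?c = "const_path (\<sigma> 0)" and ?d = "const_path (\<tau> 1)"
  have cd: "?c \<in> paths T" "?d \<in> paths T"
    using * path_at[of \<sigma> 0] path_at[of \<tau> 1] by (simp_all add: const_path_in)
  have \<gamma>: "?\<gamma> \<in> paths T" using * by (simp add: concat_in composable_def)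
  have "path_equiv T (\<sigma> \<bullet>\<^sub>p \<gamma> \<bullet>\<^sub>p \<tau>) ?\<gamma>"
    using * by (intro path_equiv_sym[OF path_equiv_concat_assoc]) (simp_all add: composable_def)
  also have "path_equiv T \<dots> (?\<gamma> \<bullet>\<^sub>p ?d)"
    using path_equiv_concat_const[OF \<gamma>] by simp
  also have "path_equiv T \<dots> (?c \<bullet>\<^sub>p ?\<gamma> \<bullet>\<^sub>p ?d)"
    using path_equiv_const_concat[of "?\<gamma> \<bullet>\<^sub>p ?d"] \<gamma> cd by (simp add: concat_in composable_def)
  finally have "path_equiv T (\<sigma> \<bullet>\<^sub>p \<gamma> \<bullet>\<^sub>p \<tau>) (?c \<bullet>\<^sub>p ?\<gamma> \<bullet>\<^sub>p ?d)" .
  moreover have "im \<sigma> \<union> im ?c = im \<sigma>" "im \<tau> \<union> im ?d = im \<tau>" by auto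
  then have "in_pixel P (im \<sigma> \<union> im ?c)" "in_pixel P (im \<tau> \<union> im ?d)"
    using assms(2,5) by simp_all
  moreover have "composable \<sigma> \<gamma>" "composable \<gamma> \<tau>" "composable ?c ?\<gamma>" "composable ?\<gamma> ?d"
    using * by (simp_all add: composable_def)
  ultimately show ?thesis
    unfolding screen_equiv_paths_def using *(1,3) cd by blast
qed

end

context screened_ideal begin

text \<open>With uniform witnesses the composites \<tau>f\<sigma> and \<tau>'g\<sigma>' agree term
  by term, and the second lies in \<open>I\<close>.\<close>

lemma screen_equiv_in_saturation:
  assumes obj: "x \<in> Obj \<C>" "y \<in> Obj \<C>" "x' \<in> Obj \<C>" "y' \<in> Obj \<C>"
    and f: "f \<in> Hom \<C> x y" and g: "g \<in> I x' y'" and "screen_equiv_mors T P x y f x' y' g"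
  shows "f \<in> ore.saturation x y"
proof -
  obtain m cs \<gamma> cs' \<delta> \<pi> where m: "\<And>i. i < m \<Longrightarrow> \<gamma> i \<in> paths_between T x y"
      "\<And>i. i < m \<Longrightarrow> \<delta> i \<in> paths_between T x' y'"
    and f': "f = (\<Sum>i<(m::nat). scaled_path T (cs i) (\<gamma> i))"
    and g': "g = (\<Sum>i<m. scaled_path T (cs' i) (\<delta> i))"
    and \<pi>: "\<pi> permutes {..<m}"
    and eq: "\<And>i. i < m \<Longrightarrow> cs i = cs' (\<pi> i) \<and> screen_equiv_paths T P (\<gamma> i) (\<delta> (\<pi> i))"
    using assms(7) unfolding screen_equiv_mors_def by blast
  have \<pi>_less: "\<pi> i < m" if "i < m" for i using permutes_in_image[OF \<pi>, of i] that by simp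
  have g'': "g = (\<Sum>i<m. scaled_path T (cs i) (\<delta> (\<pi> i)))"
    unfolding g' using eq by (subst sum.permute[OF \<pi>]) simp
  show ?thesis
  \<comment> \<open>Uniform witnesses are taken from an existing summand; the empty sum is zero and
    is treated apart.\<close>
  proof (cases "m = 0")
    case True
    then show ?thesis using f' ore.sat.ideal_zero obj by simp
  next
    case False
    then have "0 < m" by simp
    have \<delta>: "\<And>i. i < m \<Longrightarrow> \<delta> (\<pi> i) \<in> paths_between T x' y'" using m(2) \<pi>_less by blast
    have eq': "\<And>i. i < m \<Longrightarrow> screen_equiv_paths T P (\<gamma> i) (\<delta> (\<pi> i))" using eq by blast
    obtain \<sigma> w \<sigma>' \<tau> z \<tau>' where *:
      "\<sigma> \<in> paths_between T w x" "\<sigma>' \<in> paths_between T w x'" "in_pixel P (im \<sigma>)" "in_pixel P (im \<sigma>')"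
      "\<tau> \<in> paths_between T y z" "\<tau>' \<in> paths_between T y' z" "in_pixel P (im \<tau>)" "in_pixel P (im \<tau>')"
      "\<forall>i<m. path_equiv T ((\<sigma> \<bullet>\<^sub>p \<gamma> i) \<bullet>\<^sub>p \<tau>) ((\<sigma>' \<bullet>\<^sub>p \<delta> (\<pi> i)) \<bullet>\<^sub>p \<tau>')"
      using screen_equiv_paths_uniform[OF \<open>0 < m\<close> m(1) \<delta> eq'] .
    have wz: "w \<in> Obj \<C>" "z \<in> Obj \<C>"
      using *(1,5) path_at[of \<sigma> 0] path_at[of \<tau> 1] by (auto simp: paths_between_def)
    have "Comp \<C> w y z (path_mor T \<tau>) (Comp \<C> w x y f (path_mor T \<sigma>)) =
        (\<Sum>i<m. scaled_path T (cs i) ((\<sigma> \<bullet>\<^sub>p \<gamma> i) \<bullet>\<^sub>p \<tau>))"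
      unfolding f' path_category_simps(3) by (rule lin_path_comp_sandwich[OF *(1,5) m(1)])
    also have "\<dots> = (\<Sum>i<m. scaled_path T (cs i) ((\<sigma>' \<bullet>\<^sub>p \<delta> (\<pi> i)) \<bullet>\<^sub>p \<tau>'))"
      using *(9) by (intro sum.cong[OF refl scaled_path_cong]) simp
    also have "\<dots> = Comp \<C> w y' z (path_mor T \<tau>') (Comp \<C> w x' y' g (path_mor T \<sigma>'))"
      unfolding g'' path_category_simps(3) by (rule lin_path_comp_sandwich[OF *(2,6) \<delta>, symmetric])
    also have "\<dots> \<in> I w z"
      by (intro pre.ideal_comp_left[of w y' z] pre.ideal_comp_right[of w x' y']
          path_mor_in_Hom[OF *(2)] path_mor_in_Hom[OF *(6)] obj wz g)
    finally show ?thesis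
      by (rule ore.saturationI[OF f wz pixel_morsI[OF *(1,3)] pixel_morsI[OF *(5,7)]])
  qed
qed

text \<open>The required member of \<open>I\<close> is the composite \<tau>f\<sigma> itself: each
  path of \<open>f\<close> is screen equivalent to its prolongation by pixel paths.\<close>

lemma saturation_screen_equiv:
  assumes obj: "x \<in> Obj \<C>" "y \<in> Obj \<C>" and "f \<in> ore.saturation x y"
  shows "\<exists>x'\<in>Obj \<C>. \<exists>y'\<in>Obj \<C>. \<exists>g\<in>I x' y'. screen_equiv_mors T P x y f x' y' g"
proof -
  obtain w z \<sigma> \<tau> where f: "f \<in> Hom \<C> x y" and wz: "w \<in> Obj \<C>" "z \<in> Obj \<C>" "\<sigma> \<in> W w x" "\<tau> \<in> W y z"
      "Comp \<C> w y z \<tau> (Comp \<C> w x y f \<sigma>) \<in> I w z"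
    using assms(3) by (rule ore.saturationE)
  show ?thesis
  proof (cases "x = None \<or> y = None")
    case True
    \<comment> \<open>No path starts or ends at the zero object, and the empty sum shows that 0 is
      equivalent to 0.\<close>
    then have "f = 0" using f Hom_path_category_None by blast
    then have "screen_equiv_mors T P x y f x y 0"
      unfolding screen_equiv_mors_def
      by (intro exI[of _ "0 :: nat"]) simp
    then show ?thesis using obj pre.ideal_zero by blast
  next
    case False
    obtain s where s: "s \<in> paths_between T w x" "in_pixel P (im s)" "\<sigma> = path_mor T s"
      by (rule pixel_morsE[OF wz(3)]) (use False in blast)+
    obtain t where t: "t \<in> paths_between T y z" "in_pixel P (im t)" "\<tau> = path_mor T t"
      by (rule pixel_morsE[OF wz(4)]) (use False in blast)+
    obtain n :: nat and \<gamma> cs where \<gamma>: "\<And>i. i < n \<Longrightarrow> \<gamma> i \<in> paths_between T x y"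
      "f = (\<Sum>i<n. scaled_path T (cs i) (\<gamma> i))"
      using Hom_path_category_enumerate[OF f] by blast
    define \<delta> where "\<delta> i = (s \<bullet>\<^sub>p \<gamma> i) \<bullet>\<^sub>p t" for i
    define g where "g = (\<Sum>i<n. scaled_path T (cs i) (\<delta> i))"
    have "g \<in> I w z"
      using wz(5) unfolding \<gamma>(2) s(3) t(3) path_category_simps(3) g_def \<delta>_def
      by (simp only: lin_path_comp_sandwich[OF s(1) t(1) \<gamma>(1)])
    have \<delta>: "\<delta> i \<in> paths_between T w z" "screen_equiv_paths T P (\<gamma> i) (\<delta> i)" if "i < n" for i
      unfolding \<delta>_def
      using lin_path_comp_scaled(2)[OF lin_path_comp_scaled(2)[OF s(1) \<gamma>(1)[OF that]] t(1)]
        screen_equiv_sandwich[OF s(1,2) \<gamma>(1)[OF that] t(1,2)] .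
    have "screen_equiv_mors T P x y f w z g"
      unfolding screen_equiv_mors_def
      by (rule exI[of _ n], rule exI[of _ cs], rule exI[of _ \<gamma>], rule exI[of _ cs],
          rule exI[of _ \<delta>], rule exI[of _ id])
        (simp add: \<gamma> \<delta> g_def permutes_id)
    then show ?thesis using wz(1,2) \<open>g \<in> I w z\<close> by blast
  qed
qed

text \<open>The generating morphisms already form an ideal, the saturation, so generating adds
  nothing.\<close>

lemma screen_completion_eq_saturation:
  assumes obj: "x \<in> Obj \<C>" "y \<in> Obj \<C>"
  shows "screen_completion T P I x y = ore.saturation x y"
proof -
  define G where "G u v = {f \<in> Hom \<C> u v. \<exists>x'\<in>Obj \<C>. \<exists>y'\<in>Obj \<C>. \<exists>g\<in>I x' y'.
    screen_equiv_mors T P u v f x' y' g}" for u v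
  have K: "screen_completion T P I = ideal_generated \<C> G"
    by (simp only: screen_completion_def Let_def G_def[abs_def])
  have "G u v = ore.saturation u v" if "u \<in> Obj \<C>" "v \<in> Obj \<C>" for u v
  proof (intro equalityI subsetI)
    show "f \<in> ore.saturation u v" if "f \<in> G u v" for f
      using that screen_equiv_in_saturation[OF \<open>u \<in> Obj \<C>\<close> \<open>v \<in> Obj \<C>\<close>] unfolding G_def by blast
    show "f \<in> G u v" if "f \<in> ore.saturation u v" for f
      using saturation_screen_equiv[OF \<open>u \<in> Obj \<C>\<close> \<open>v \<in> Obj \<C>\<close> that]
        ore.sat.ideal_sub[OF \<open>u \<in> Obj \<C>\<close> \<open>v \<in> Obj \<C>\<close> that] unfolding G_def by blast
  qed
  then show ?thesis
    unfolding K ideal_generated_def using obj ore.sat.ideal ore.sat.ideal_sub[OF obj] by blast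
qed

section \<open>The calculus of fractions\<close>

abbreviation "K \<equiv> screen_completion T P I"

section \<open>Pre-dead pixels\<close>

lemma pre_dead_iff:
  "pre_dead T I X \<longleftrightarrow> (\<exists>\<rho>\<in>paths T. im \<rho> \<subseteq> X \<and> path_mor T \<rho> \<in> I (Some (\<rho> 0)) (Some (\<rho> 1)))"
proof -
  have "path_residue T I \<rho> = residue_class I (Some (\<rho> 0)) (Some (\<rho> 1)) 0 \<longleftrightarrow>
      path_mor T \<rho> \<in> I (Some (\<rho> 0)) (Some (\<rho> 1))" if "\<rho> \<in> paths T" for \<rho>
    unfolding path_residue_def
    using path_at[OF that, of 0] path_at[OF that, of 1] by (intro pre.residue_class_eq_0_iff) auto
  then show ?thesis unfolding pre_dead_def by blast
qed

text \<open>One dead path kills the whole pixel: directedness gives a route from \<open>w\<close> to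
  \<open>z\<close> through \<rho> and another through \<open>a\<close>. They are parallel in
  \<open>X\<close>, hence equivalent by (S1), so the route through \<open>a\<close> is in
  \<open>I\<close>, and its two halves witness that the identity of \<open>a\<close> lies in the
  saturation.\<close>

lemma pre_dead_null_object:
  assumes X: "X \<in> P" "pre_dead T I X" and a: "a \<in> X"
  shows "Ident \<C> (Some a) \<in> ore.saturation (Some a) (Some a)"
proof -
  obtain \<rho> where \<rho>: "\<rho> \<in> paths T" "im \<rho> \<subseteq> X" "path_mor T \<rho> \<in> I (Some (\<rho> 0)) (Some (\<rho> 1))"
    using X(2) by (auto simp: pre_dead_iff)
  then have in_X: "{\<rho> 0, a} \<subseteq> X" "{\<rho> 1, a} \<subseteq> X" using a by auto
  obtain w z where wz: "reachable_in T X w (\<rho> 0)" "reachable_in T X w a"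
      "reachable_in T X (\<rho> 1) z" "reachable_in T X a z"
    using pixel_codirected[OF X(1) _ _ in_X(1)] pixel_directed[OF X(1) _ _ in_X(2)] by auto
  obtain p p' q q' where pq:
      "p \<in> paths T" "p 0 = w" "p 1 = \<rho> 0" "im p \<subseteq> X" "q \<in> paths T" "q 0 = w" "q 1 = a" "im q \<subseteq> X"
      "p' \<in> paths T" "p' 0 = \<rho> 1" "p' 1 = z" "im p' \<subseteq> X" "q' \<in> paths T" "q' 0 = a" "q' 1 = z" "im q' \<subseteq> X"
    using wz unfolding reachable_in_def by blast
  have between: "p \<in> paths_between T (Some w) (Some (\<rho> 0))" "p' \<in> paths_between T (Some (\<rho> 1)) (Some z)"
      "\<rho> \<in> paths_between T (Some (\<rho> 0)) (Some (\<rho> 1))"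
      "q \<in> paths_between T (Some w) (Some a)" "q' \<in> paths_between T (Some a) (Some z)"
    using pq \<rho> by (auto simp: paths_between_def)
  have obj: "Some w \<in> Obj \<C>" "Some z \<in> Obj \<C>" "Some a \<in> Obj \<C>" "Some (\<rho> 0) \<in> Obj \<C>" "Some (\<rho> 1) \<in> Obj \<C>"
    using pq path_at[of p 0] path_at[of p' 1] path_at[of q 1] path_at[of \<rho> 0] path_at[of \<rho> 1] \<rho> by auto
  have "path_equiv T (q \<bullet>\<^sub>p q') ((p \<bullet>\<^sub>p \<rho>) \<bullet>\<^sub>p p')"
    using pixel_paths_equiv_iff[OF X(1), of "q \<bullet>\<^sub>p q'" "(p \<bullet>\<^sub>p \<rho>) \<bullet>\<^sub>p p'"] pq \<rho>
    by (simp add: concat_in composable_def image_path_concat)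
  then have "path_mor T (q \<bullet>\<^sub>p q') = (path_mor T ((p \<bullet>\<^sub>p \<rho>) \<bullet>\<^sub>p p') :: ('a, 'k) lin_path)"
    unfolding path_mor_def by (rule scaled_path_cong)
  also have "\<dots> = Comp \<C> (Some w) (Some (\<rho> 1)) (Some z) (path_mor T p')
      (Comp \<C> (Some w) (Some (\<rho> 0)) (Some (\<rho> 1)) (path_mor T \<rho>) (path_mor T p))"
    by (simp add: path_mor_concat[OF between(1,3)]
        path_mor_concat[OF lin_path_comp_scaled(2)[OF between(1,3)] between(2)])
  also have "\<dots> \<in> I (Some w) (Some z)"
    using obj \<rho> between path_mor_in_Hom
    by (intro pre.ideal_comp_left[of _ "Some (\<rho> 1)"] pre.ideal_comp_right[of _ "Some (\<rho> 0)"]) auto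
  finally have "Comp \<C> (Some w) (Some a) (Some z) (path_mor T q') (path_mor T q) \<in> I (Some w) (Some z)"
    by (simp add: path_mor_concat[OF between(4,5)])
  moreover have "Comp \<C> (Some w) (Some a) (Some a) (Ident \<C> (Some a)) (path_mor T q) = path_mor T q"
    using obj between path_mor_in_Hom by (intro pre.comp_ident_left) auto
  ultimately show ?thesis
    using obj between pq X
    by (intro ore.saturationI[of _ _ _ "Some w" "Some z" "path_mor T q" "path_mor T q'"] pixel_morsI pre.ident_in)
      (auto simp: in_pixel_def)
qed

lemma path_residue_eq:
  "\<rho> \<in> paths_between T x y \<Longrightarrow> path_residue T L \<rho> = residue_class L x y (path_mor T \<rho>)"
  by (auto simp: path_residue_def paths_between_def)

text \<open>Prolonging \<rho> by the witnesses \<open>s\<close> and \<open>t\<close> stays in the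
  pixel and lands in \<open>I\<close>, the ideal to which pre-deadness refers.\<close>

lemma saturation_pixel_pre_dead:
  assumes \<rho>: "\<rho> \<in> paths_between T x y" "im \<rho> \<subseteq> X" and X: "X \<in> P"
    and "path_mor T \<rho> \<in> ore.saturation x y"
  shows "pre_dead T I X"
proof -
  obtain w z \<sigma> \<tau> where wz: "\<sigma> \<in> W w x" "\<tau> \<in> W y z"
      "Comp \<C> w y z \<tau> (Comp \<C> w x y (path_mor T \<rho>) \<sigma>) \<in> I w z"
    using assms(4) by (rule ore.saturationE)
  obtain s t where s: "s \<in> paths_between T w x" "in_pixel P (im s)" "\<sigma> = path_mor T s"
    and t: "t \<in> paths_between T y z" "in_pixel P (im t)" "\<tau> = path_mor T t"
    using wz(1,2) \<rho> by (auto elim!: pixel_morsE simp: paths_between_def)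
  let ?\<rho> = "(s \<bullet>\<^sub>p \<rho>) \<bullet>\<^sub>p t"
  have between: "?\<rho> \<in> paths_between T w z"
    by (intro lin_path_comp_scaled(2)[OF lin_path_comp_scaled(2)[OF s(1) \<rho>(1)] t(1)])
  have \<rho>01: "\<rho> 0 \<in> X" "\<rho> 1 \<in> X" using \<rho> by auto
  have comp: "composable s \<rho>" "composable \<rho> t"
    using s t \<rho> by (auto simp: paths_between_def composable_def)
  have "im s \<subseteq> X" "im t \<subseteq> X"
    using in_pixel_start[OF s(2) X, of "s 1"] in_pixel_start[OF t(2) X, of "t 0"] \<rho>01 comp
    by (simp_all add: composable_def)
  then have "im ?\<rho> \<subseteq> X"
    using \<rho>(2) comp by (simp add: image_path_concat composable_def)
  moreover have "path_mor T ?\<rho> \<in> I w z"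
    using wz(3)
    by (simp add: s(3) t(3) path_mor_concat[OF s(1) \<rho>(1)]
        path_mor_concat[OF lin_path_comp_scaled(2)[OF s(1) \<rho>(1)] t(1)])
  moreover have "?\<rho> \<in> paths T" "w = Some (?\<rho> 0)" "z = Some (?\<rho> 1)"
    using between by (auto simp: paths_between_def)
  ultimately show ?thesis unfolding pre_dead_iff by blast
qed

sublocale com: preadditive_ideal \<C> K
  by (rule ore.sat.ideal_cong[OF screen_completion_eq_saturation])

section \<open>Decomposition and closure of the class of fractions\<close>

lemma screen_sigma_cases:
  assumes "s \<in> screen_sigma T P I x y"
  obtains (residue) \<sigma> where "\<sigma> \<in> W x y" "s = residue_class K x y \<sigma>"
    | (dead) X a b where "X \<in> P" "pre_dead T I X" "a \<in> X" "b \<in> X" "x = Some a" "y = Some b"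
        "s = residue_class K x y 0"
  using assms unfolding screen_sigma_def Let_def path_category_simps(4)
proof (elim UnE CollectE exE conjE)
  fix \<rho> assume \<rho>: "s = path_residue T K \<rho>" "\<rho> \<in> paths_between T x y" "in_pixel P (im \<rho>)"
  show thesis
    by (rule residue[OF pixel_morsI[OF \<rho>(2,3)]]) (simp only: \<rho>(1) path_residue_eq[OF \<rho>(2)])
next
  fix X assume X: "s = residue_class K x y 0" "X \<in> P" "pre_dead T I X" "x \<in> Some ` X" "y \<in> Some ` X"
  obtain a b where "a \<in> X" "b \<in> X" "x = Some a" "y = Some b" using X(4,5) by blast
  then show thesis using dead[OF X(2,3)] X(1) by simp
next
  \<comment> \<open>The identity of the zero object is the residue of the extra zero in
    \<open>W None None\<close>, so it needs no case of its own.\<close>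
  assume "s \<in> (if x = None \<and> y = None then {residue_class K x y 0} else {})"
  then have "x = None" "y = None" "s = residue_class K x y 0" by (simp_all split: if_splits)
  then show thesis using residue[of 0] by (simp add: pixel_mors_def)
qed

lemma screen_sigma_residueI:
  assumes "\<rho> \<in> paths_between T x y" "in_pixel P (im \<rho>)" "path_residue T K \<rho> \<noteq> residue_class K x y 0"
  shows "path_residue T K \<rho> \<in> screen_sigma T P I x y"
  unfolding screen_sigma_def Let_def using assms by (intro UnI1 CollectI exI[of _ \<rho>]) simp

lemma screen_sigma_deadI:
  assumes "X \<in> P" "pre_dead T I X" "x \<in> Some ` X" "y \<in> Some ` X"
  shows "residue_class K x y 0 \<in> screen_sigma T P I x y"
  unfolding screen_sigma_def Let_def using assms by (intro UnI1[OF UnI2] CollectI exI[of _ X]) simp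

text \<open>A pixel morphism whose residue vanishes forces its pixel to be pre-dead, and then the
  zero morphism was adjoined to the class.\<close>

lemma residue_in_screen_sigma:
  assumes "x \<in> Obj \<C>" "y \<in> Obj \<C>" "\<sigma> \<in> W x y"
  shows "residue_class K x y \<sigma> \<in> screen_sigma T P I x y"
  using assms(3)
proof (cases rule: pixel_morsE)
  case (path \<rho>)
  have res: "path_residue T K \<rho> = residue_class K x y \<sigma>"
    unfolding path(3) by (rule path_residue_eq[OF path(1)])
  show ?thesis
  proof (cases "path_residue T K \<rho> = residue_class K x y 0")
    case False
    then show ?thesis using screen_sigma_residueI[OF path(1,2)] unfolding res by blast
  next
    case True
    then have "path_mor T \<rho> \<in> K x y"
      unfolding res path(3) com.residue_class_eq_0_iff[OF assms(1,2)] .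
    then have dead: "path_mor T \<rho> \<in> ore.saturation x y"
      unfolding screen_completion_eq_saturation[OF assms(1,2)] .
    obtain X where X: "X \<in> P" "im \<rho> \<subseteq> X" using path(2) unfolding in_pixel_def by blast
    have "\<rho> 0 \<in> X" "\<rho> 1 \<in> X" using X(2) by auto
    then have "x \<in> Some ` X" "y \<in> Some ` X" using path(1) unfolding paths_between_def by blast+
    then show ?thesis
      using screen_sigma_deadI[OF X(1) saturation_pixel_pre_dead[OF path(1) X(2,1) dead]] True
      unfolding res by simp
  qed
qed (simp add: screen_sigma_def Let_def)

text \<open>Carries pre-deadness from the middle object of a composite to its outer objects.\<close>

lemma screen_sigma_same_pixel:
  assumes "s \<in> screen_sigma T P I x y" "X \<in> P"
  shows "x \<in> Some ` X \<longleftrightarrow> y \<in> Some ` X"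
  using assms(1)
proof (cases rule: screen_sigma_cases)
  case (residue \<sigma>)
  from residue(1) show ?thesis
  proof (cases rule: pixel_morsE)
    case (path \<rho>)
    then have "im \<rho> \<subseteq> X" if "\<rho> 0 \<in> X \<or> \<rho> 1 \<in> X"
      using that in_pixel_start[OF path(2) assms(2), of "\<rho> 0"] in_pixel_start[OF path(2) assms(2), of "\<rho> 1"]
      by auto
    moreover have "\<rho> 0 \<in> im \<rho>" "\<rho> 1 \<in> im \<rho>" by auto
    ultimately have "\<rho> 0 \<in> X \<longleftrightarrow> \<rho> 1 \<in> X" by blast
    then show ?thesis using path(1) by (auto simp: paths_between_def)
  qed simp
next
  case (dead Y a b)
  then show ?thesis using pixel_unique assms(2) by blast
qed

lemma residue_of_Hom:
  assumes "x \<in> Obj \<C>" "y \<in> Obj \<C>" "s \<in> screen_sigma T P I x y"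
  shows "\<exists>f\<in>Hom \<C> x y. s = residue_class K x y f"
  using assms(3)
proof (cases rule: screen_sigma_cases)
  case (residue \<sigma>)
  then show ?thesis using pixel_mors_sub[OF residue(1)] by blast
next
  case dead
  then show ?thesis using pre.zero_in[OF assms(1,2)] by blast
qed

sublocale frac: fraction_class \<C> I W K "screen_sigma T P I"
proof
  fix x y assume obj: "x \<in> Obj \<C>" "y \<in> Obj \<C>"
  show "K x y = ore.saturation x y" using obj by (rule screen_completion_eq_saturation)
  show "screen_sigma T P I x y \<subseteq> residue_class K x y ` Hom \<C> x y"
    using residue_of_Hom[OF obj] by blast
  show "residue_class K x y \<sigma> \<in> screen_sigma T P I x y" if "\<sigma> \<in> W x y" for \<sigma>
    using residue_in_screen_sigma obj that .
  show "s \<in> residue_class K x y ` W x y \<or> Ident \<C> x \<in> K x x \<and> Ident \<C> y \<in> K y y"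
    if "s \<in> screen_sigma T P I x y" for s
    using that
  proof (cases rule: screen_sigma_cases)
    case (dead X a b)
    then show ?thesis
      using pre_dead_null_object obj screen_completion_eq_saturation by blast
  qed blast
  fix z s t
  assume z: "z \<in> Obj \<C>" and s: "s \<in> screen_sigma T P I x y" and t: "t \<in> screen_sigma T P I y z"
  show "Comp (quotient_category \<C> K) x y z t s \<in> screen_sigma T P I x z"
  \<comment> \<open>If the pixel of \<open>y\<close> is pre-dead, all three objects are null and the
    composite is an adjoined zero morphism. Otherwise neither factor is of the dead kind, as its
    dead pixel would contain \<open>y\<close>, so both lift to \<open>W\<close>.\<close>
  proof (cases "\<exists>X\<in>P. pre_dead T I X \<and> y \<in> Some ` X")
    case True
    then obtain X where X: "X \<in> P" "pre_dead T I X" "y \<in> Some ` X" by blast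
    then have xz: "x \<in> Some ` X" "z \<in> Some ` X"
      using screen_sigma_same_pixel[OF s X(1)] screen_sigma_same_pixel[OF t X(1)] by auto
    then have null: "Ident \<C> x \<in> K x x"
      using pre_dead_null_object[OF X(1,2)] obj screen_completion_eq_saturation by blast
    obtain f g where fg: "f \<in> Hom \<C> x y" "s = residue_class K x y f" "g \<in> Hom \<C> y z" "t = residue_class K y z g"
      using residue_of_Hom[OF obj s] residue_of_Hom[OF obj(2) z t] by blast
    then obtain h where h: "h \<in> Hom \<C> x z" "Comp (quotient_category \<C> K) x y z t s = residue_class K x z h"
      using com.quotient_comp[OF obj z fg(1,3)] pre.comp_in[OF obj z fg(1,3)] by blast
    have "Comp \<C> x x z h (Ident \<C> x) \<in> K x z"
      using obj z null h(1) by (intro com.ideal_comp_left[of x x z])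
    then have "residue_class K x z h = residue_class K x z 0"
      using obj z h(1) by (simp only: com.residue_class_eq_0_iff pre.comp_ident_right)
    moreover have "residue_class K x z 0 \<in> screen_sigma T P I x z"
      using X(1,2) xz by (rule screen_sigma_deadI)
    ultimately show ?thesis using h by simp
  next
    case False
    obtain \<sigma> where \<sigma>: "\<sigma> \<in> W x y" "s = residue_class K x y \<sigma>"
      using s False by (cases rule: screen_sigma_cases) blast+
    obtain \<tau> where \<tau>: "\<tau> \<in> W y z" "t = residue_class K y z \<tau>"
      using t False by (cases rule: screen_sigma_cases) blast+
    have "Comp (quotient_category \<C> K) x y z t s = residue_class K x z (Comp \<C> x y z \<tau> \<sigma>)"
      unfolding \<sigma>(2) \<tau>(2) using obj z \<sigma>(1) \<tau>(1) by (intro com.quotient_comp pixel_mors_sub)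
    then show ?thesis
      using residue_in_screen_sigma[OF obj(1) z pixel_mors_comp[OF \<sigma>(1) \<tau>(1)]] by simp
  qed
qed

end

theorem proposition2p19:
  fixes T :: "'a triple"
    and I :: "'a option \<Rightarrow> 'a option \<Rightarrow> ('a, 'k::{comm_ring,comm_monoid_mult}) lin_path set"
    and P :: "'a set set"
  assumes "is_triple T"
    and "path_based_ideal T I"
    and "is_screen T P"
  shows "admits_calculus_of_fractions
           (quotient_category (path_category T) (screen_completion T P I))
           (screen_sigma T P I)"
proof -
  interpret screened_ideal T P I
    using assms by unfold_locales (auto simp: path_based_ideal_def)
  show ?thesis by (rule frac.fraction_class_calculus_of_fractions)
qed

end
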